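(* Let $\mathcal P$ be the set of all primes and let $\mathcal P_2=\mathcal P\cup\{p_1p_2:\, p_1,p_2\in\mathcal P\}$ (the set of positive integers that are either a prime or a product of two, not necessarily distinct, primes). Then the sumset $$2^{\mathcal P}+\mathcal P_2=\{2^{p}+q:\, p\in\mathcal P,\ q\in\mathcal P_2\}$$ has positive lower density; that is, there exists a constant $c>0$ such that $|\{1\le n\le x:\, n\in 2^{\mathcal P}+\mathcal P_2\}|>cx$ for all sufficiently large $x$.
   Context: For a set $A$ of positive integers, its lower (asymptotic) density is $\liminf_{x\to\infty} A(x)/x$, where $A(x)=|\{1\le a\le x:\, a\in A\}|$. *)

theory Defs
  imports "HOL-Analysis.Analysis" "HOL-Computational_Algebra.Primes"
begin

definition counting :: "nat set \<Rightarrow> real \<Rightarrow> nat" where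
  "counting A x = card {a \<in> A. 1 \<le> a \<and> real a \<le> x}"

definition lower_density :: "nat set \<Rightarrow> ereal" where
  "lower_density A = Liminf at_top (\<lambda>x::real. ereal (real (counting A x) / x))"

definition P2 :: "nat set" where
  "P2 = {p. prime p} \<union> {p1 * p2 | p1 p2. prime p1 \<and> prime p2}"

definition sumset_2P_P2 :: "nat set" where
  "sumset_2P_P2 = {2 ^ p + q | p q. prime (p::nat) \<and> q \<in> P2}"

end

theory Submission
  imports Defs "HOL-Number_Theory.Number_Theory" "HOL-Real_Asymp.Real_Asymp"
begin

text \<open>
  The proof is a second moment argument in the style of Romanoff. Let \<open>w = x\<^sup>1\<^sup>/\<^sup>4\<close> and let
  \<open>r n\<close> count the representations \<open>n = 2\<^sup>p + a b\<close> with primes \<open>p\<close> and \<open>a \<le> w < b\<close>.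
  Chebyshev's and Mertens' bounds give \<open>\<Sum>r n \<ge> c x\<close>: the factor \<open>log log x\<close> gained from
  the sum of \<open>1/a\<close> makes up for the loss of \<open>log log x\<close> in the number of exponents \<open>p\<close>.
  By Cauchy--Schwarz it remains to prove \<open>\<Sum>(r n)\<^sup>2 \<le> C x\<close>. Selberg's sieve bounds the number
  of \<open>(b, b')\<close> with \<open>a b - a' b' = 2\<^bsup>p'\<^esup> - 2\<^sup>p\<close> up to a singular series depending on
  \<open>2\<^bsup>p' - p\<^esup> - 1\<close>. The same sieve bounds the number of pairs \<open>(p, p')\<close> with a given difference \<open>k\<close>,
  so primality of the exponents costs nothing further, and Romanoff's argument bounds the mean of
  the singular series over all \<open>k\<close>.
\<close>

subsection \<open>Selberg's sieve with two residue classes per prime\<close>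

text \<open>In the second moment the logarithms balance exactly: for fixed \<open>p < p'\<close>,
  \<open>a\<close>, \<open>c\<close> the sieve allows order \<open>X / (lcm a c * (log X)^2)\<close>
  solutions up to the singular series, the sum over \<open>a\<close>, \<open>c\<close> contributes
  (log log X)^2, and there are order (log X / log log X)^2 pairs of exponents. No logarithmic loss
  is affordable anywhere, while constants are free. This is why crude Chebyshev and Mertens bounds
  suffice. Two singular series meet at the difference \<open>k = p' - p\<close>: the squares of
  \<open>phi_ratio k\<close> and of \<open>phi_ratio (2 ^ k - 1)\<close>. The inequality 2uv <= u^2
  + v^2 separates them, hence the fourth powers that are averaged. For \<open>2 ^ k - 1\<close> the
  primes are grouped by the multiplicative order of 2, which divides \<open>k\<close>; at most
  \<open>e\<close> primes have order \<open>e\<close>, and this sparsity keeps the average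
  bounded.\<close>

lemma card_residue_system:
  fixes S :: "nat set" and R :: "nat \<Rightarrow> nat set"
  assumes fin: "finite S" and pr: "\<And>p. p \<in> S \<Longrightarrow> prime p" and R: "\<And>p. p \<in> S \<Longrightarrow> R p \<subseteq> {..<p}"
  shows "card {n. n < \<Prod>S \<and> (\<forall>p\<in>S. n mod p \<in> R p)} = (\<Prod>p\<in>S. card (R p))"
proof -
  have cop: "\<forall>i\<in>S. \<forall>j\<in>S. i \<noteq> j \<longrightarrow> coprime i j"
    using pr primes_coprime by blast
  have nz: "\<forall>i\<in>S. i \<noteq> 0" using pr not_prime_0 by metis
  have "bij_betw (\<lambda>n. restrict (\<lambda>p. n mod p) S) {n. n < \<Prod>S \<and> (\<forall>p\<in>S. n mod p \<in> R p)} (PiE S R)"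
    unfolding bij_betw_def
  proof
    show "inj_on (\<lambda>n. restrict (\<lambda>p. n mod p) S) {n. n < \<Prod>S \<and> (\<forall>p\<in>S. n mod p \<in> R p)}"
    proof (rule inj_onI, clarify)
      fix m n assume mn: "m < \<Prod>S" "n < \<Prod>S" 
        and eq: "restrict (\<lambda>p. m mod p) S = restrict (\<lambda>p. n mod p) S"
      have "\<forall>i\<in>S. [m = n] (mod i)"
        using eq unfolding cong_def by (metis restrict_apply')
      moreover have "\<exists>!x. x < (\<Prod>i\<in>S. i) \<and> (\<forall>i\<in>S. [x = n] (mod i))"
        by (rule chinese_remainder_unique_nat[OF fin nz cop])
      ultimately show "m = n" using mn by (metis cong_refl)
    qed
    show "(\<lambda>n. restrict (\<lambda>p. n mod p) S) ` {n. n < \<Prod>S \<and> (\<forall>p\<in>S. n mod p \<in> R p)} = PiE S R"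
    proof (intro equalityI subsetI)
      fix u assume u: "u \<in> PiE S R"
      obtain x where x: "x < (\<Prod>i\<in>S. i)" "\<forall>i\<in>S. [x = u i] (mod i)"
        using chinese_remainder_unique_nat[OF fin nz cop] by blast
      have xu: "x mod p = u p" if "p \<in> S" for p
      proof -
        have "u p < p" using u R that by (metis PiE_mem in_mono lessThan_iff)
        then show ?thesis using x that by (simp add: cong_def)
      qed
      have "restrict (\<lambda>p. x mod p) S = u"
        using u xu by (intro ext) (auto simp: restrict_def PiE_def extensional_def)
      moreover have "\<forall>p\<in>S. x mod p \<in> R p" using xu u by (auto simp: PiE_mem)
      ultimately show "u \<in> (\<lambda>n. restrict (\<lambda>p. n mod p) S) ` {n. n < \<Prod>S \<and> (\<forall>p\<in>S. n mod p \<in> R p)}"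
        using x(1) by auto
    qed auto
  qed
  then have "card {n. n < \<Prod>S \<and> (\<forall>p\<in>S. n mod p \<in> R p)} = card (PiE S R)"
    by (rule bij_betw_same_card)
  then show ?thesis by (simp add: card_PiE fin)
qed

text \<open>Each full period contributes exactly the expected number, so the induction strips
  periods. In the incomplete last one the count and its expectation both lie between 0 and the
  bound.\<close>

lemma card_residue_system_interval:
  fixes S :: "nat set" and R :: "nat \<Rightarrow> nat set"
  assumes fin: "finite S" and pr: "\<And>p. p \<in> S \<Longrightarrow> prime p" and R: "\<And>p. p \<in> S \<Longrightarrow> R p \<subseteq> {..<p}"
  shows "\<bar>real (card {n. n < N \<and> (\<forall>p\<in>S. n mod p \<in> R p)}) - real N * (\<Prod>p\<in>S. card (R p) / p)\<bar>
           \<le> (\<Prod>p\<in>S. card (R p))"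
proof (induction N rule: less_induct)
  case (less N)
  define d where "d = \<Prod>S"
  define K where "K = (\<Prod>p\<in>S. card (R p))"
  define c where "c N = {n. n < N \<and> (\<forall>p\<in>S. n mod p \<in> R p)}" for N
  have finc: "finite (c N)" for N unfolding c_def by simp
  have d0: "d > 0" unfolding d_def using pr by (intro prod_pos) (auto simp: prime_gt_0_nat)
  have Kd: "(\<Prod>p\<in>S. real (card (R p)) / real p) = real K / real d"
    unfolding K_def d_def by (simp add: prod_dividef)
  have cd: "card (c d) = K"
    unfolding c_def d_def K_def by (rule card_residue_system[OF assms])
  show ?case
  proof (cases "N < d")
    case True
    have "card (c N) \<le> card (c d)"
      by (rule card_mono[OF finc]) (use True in \<open>auto simp: c_def\<close>)
    then have "real (card (c N)) \<le> K" using cd by simp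
    moreover have "real N * (real K / real d) \<le> K"
    proof -
      have "real N * (real K / real d) = real K * (real N / real d)" by simp
      also have "\<dots> \<le> real K * 1" using True d0 by (intro mult_left_mono) auto
      finally show ?thesis by simp
    qed
    moreover have "real N * (real K / real d) \<ge> 0" by simp
    ultimately show ?thesis unfolding Kd K_def[symmetric] c_def[symmetric] by linarith
  next
    case False
    define M where "M = N - d"
    have NM: "N = d + M" "M < N" using False d0 by (auto simp: M_def)
    have "c N = c d \<union> (\<lambda>n. n + d) ` c M"
    proof (intro equalityI subsetI)
      fix n assume n: "n \<in> c N"
      show "n \<in> c d \<union> (\<lambda>n. n + d) ` c M"
      proof (cases "n < d")
        case True then show ?thesis using n by (auto simp: c_def)
      next
        case False
        have "(n - d) mod p = n mod p" if "p \<in> S" for p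
        proof -
          have "p dvd d" unfolding d_def using that fin by (simp add: dvd_prod_eqI)
          then show ?thesis using False by (metis le_mod_geq mod_add_self2 dvd_def le_add_diff_inverse2 mod_mult_self2 not_less)
        qed
        then have "n - d \<in> c M" using n False NM by (auto simp: c_def)
        then show ?thesis using False by (intro UnI2 image_eqI[of _ _ "n - d"]) auto
      qed
    next
      fix n assume "n \<in> c d \<union> (\<lambda>n. n + d) ` c M"
      moreover have "(m + d) mod p = m mod p" if "p \<in> S" for m p
      proof -
        have "p dvd d" unfolding d_def using that fin by (simp add: dvd_prod_eqI)
        then show ?thesis by (metis mod_mult_self2 dvd_def)
      qed
      ultimately show "n \<in> c N" using NM by (auto simp: c_def)
    qed
    moreover have "c d \<inter> (\<lambda>n. n + d) ` c M = {}" by (auto simp: c_def)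
    ultimately have "card (c N) = card (c d) + card (c M)"
      by (simp add: card_Un_disjoint finc card_image)
    then have "real (card (c N)) - real N * (real K / real d) = real (card (c M)) - real M * (real K / real d)"
      using NM d0 cd by (simp add: field_simps)
    then show ?thesis using less[OF NM(2)] unfolding Kd K_def[symmetric] c_def[symmetric] by simp
  qed
qed

text \<open>Moebius inversion in the subset lattice: between two distinct sets there are as many
  intermediate sets of even as of odd size.\<close>

lemma sum_alternating_interval:
  assumes "finite T" "K \<subseteq> T"
  shows "(\<Sum>S\<in>{S. K \<subseteq> S \<and> S \<subseteq> T}. (-1) ^ card S) = (if K = T then (-1) ^ card K else (0::real))"
proof (cases "K = T")
  case True
  then have "{S. K \<subseteq> S \<and> S \<subseteq> T} = {T}" by auto
  then show ?thesis using True by simp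
next
  case False
  then have "K \<subset> T" using assms by auto
  have "finite {S. K \<subseteq> S \<and> S \<subseteq> T}" using assms by (auto intro: finite_subset[of _ "Pow T"])
  moreover have "card {x \<in> {S. K \<subseteq> S \<and> S \<subseteq> T}. even (card x)} = card {x \<in> {S. K \<subseteq> S \<and> S \<subseteq> T}. odd (card x)}"
    using card_subsupersets_even_odd[OF assms(1) \<open>K \<subset> T\<close>] by (simp add: conj_commute conj_left_commute)
  ultimately show ?thesis using False by (simp add: sum_alternating_cancels)
qed

lemma prod_add_one:
  fixes f :: "'a \<Rightarrow> 'b :: comm_semiring_1"
  assumes "finite A"
  shows "(\<Prod>x\<in>A. f x + 1) = (\<Sum>X\<in>Pow A. \<Prod>x\<in>X. f x)"
  using prod_add[OF assms, of f "\<lambda>_. 1"] by simp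

text \<open>A squarefree integer is encoded as the set of its prime factors, so that divisibility,
  gcd and lcm become inclusion, intersection and union.\<close>

definition smooth_sets :: "nat set \<Rightarrow> real \<Rightarrow> nat set set" where
  "smooth_sets Q D = {S. S \<subseteq> Q \<and> real (\<Prod>S) \<le> D}"

lemma finite_smooth_sets: "finite Q \<Longrightarrow> finite (smooth_sets Q D)"
  unfolding smooth_sets_def by (rule finite_subset[of _ "Pow Q"]) auto

lemma smooth_sets_mono:
  assumes "T \<in> smooth_sets Q D" "S \<subseteq> T" "finite Q" "\<And>p. p \<in> Q \<Longrightarrow> prime p"
  shows "S \<in> smooth_sets Q D"
proof -
  have fT: "finite T" using assms by (auto simp: smooth_sets_def intro: finite_subset)
  have "\<Prod>S dvd \<Prod>T" by (rule prod_dvd_prod_subset[OF fT assms(2)])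
  moreover have "\<Prod>T > 0" using assms by (intro prod_pos) (auto simp: smooth_sets_def prime_gt_0_nat)
  ultimately have "\<Prod>S \<le> \<Prod>T" by (simp add: dvd_imp_le)
  then have "real (\<Prod>S) \<le> real (\<Prod>T)" by (simp only: of_nat_le_iff)
  then show ?thesis using assms by (auto simp: smooth_sets_def)
qed

text \<open>Unique factorisation of squarefree integers: \<open>S\<close> is recovered as the set of
  primes of \<open>Q\<close> dividing its product.\<close>

lemma inj_on_Prod_primes:
  assumes "finite Q" "\<And>p. p \<in> Q \<Longrightarrow> prime (p::nat)"
  shows "inj_on (\<lambda>S. \<Prod>S) (Pow Q)"
proof (rule inj_onI)
  fix S T assume ST: "S \<in> Pow Q" "T \<in> Pow Q" "\<Prod>S = \<Prod>T"
  have "S = {p \<in> Q. p dvd \<Prod>S}" if "S \<in> Pow Q" for S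
  proof -
    have fS: "finite S" using that assms finite_subset by auto
    have "p \<in> S" if "p \<in> Q" "p dvd \<Prod>S" for p
    proof -
      have "\<exists>q\<in>S. p dvd q" using that assms prime_dvd_prod_iff[OF fS, of p "\<lambda>x. x"] by auto
      then show ?thesis using assms that \<open>S \<in> Pow Q\<close> by (metis PowD primes_dvd_imp_eq subsetD)
    qed
    moreover have "p dvd \<Prod>S" if "p \<in> S" for p using that fS by (simp add: dvd_prod_eqI)
    ultimately show ?thesis using that by auto
  qed
  then show "S = T" using ST by metis
qed

lemma card_smooth_sets:
  assumes "finite Q" "\<And>p. p \<in> Q \<Longrightarrow> prime p" "D \<ge> 0"
  shows "real (card (smooth_sets Q D)) \<le> D"
proof -
  have "inj_on (\<lambda>S. \<Prod>S) (smooth_sets Q D)"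
    by (rule inj_on_subset[OF inj_on_Prod_primes[OF assms(1,2)]]) (auto simp: smooth_sets_def)
  then have "card (smooth_sets Q D) = card ((\<lambda>S. \<Prod>S) ` smooth_sets Q D)" by (simp add: card_image)
  also have "\<dots> \<le> card {1..nat \<lfloor>D\<rfloor>}"
  proof (rule card_mono, simp, rule image_subsetI)
    fix S assume S: "S \<in> smooth_sets Q D"
    have "\<Prod>S > 0" using assms S by (intro prod_pos) (auto simp: smooth_sets_def prime_gt_0_nat)
    moreover have "\<Prod>S \<le> nat \<lfloor>D\<rfloor>" using S unfolding smooth_sets_def by (simp add: le_nat_floor del: of_nat_prod)
    ultimately show "\<Prod>S \<in> {1..nat \<lfloor>D\<rfloor>}" by simp
  qed
  finally have "real (card (smooth_sets Q D)) \<le> real (nat \<lfloor>D\<rfloor>)" by simp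
  then show ?thesis using assms(3) by linarith
qed

text \<open>The indicator of the surviving \<open>n\<close> is majorised by the square of a weighted
  sum with \<open>lam {} = 1\<close>. Expanding the square leaves a quadratic form with value
  \<open>1 / G\<close>, plus at most \<open>D ^ 2\<close> pairs with an error of at most
  \<open>D ^ 2\<close> each.\<close>

theorem selberg_sieve:
  fixes Q :: "nat set" and R :: "nat \<Rightarrow> nat set" and D :: real
  assumes fin: "finite Q" and pr: "\<And>p. p \<in> Q \<Longrightarrow> prime p" and p2: "\<And>p. p \<in> Q \<Longrightarrow> p > 2"
    and R: "\<And>p. p \<in> Q \<Longrightarrow> R p \<subseteq> {..<p}" and R2: "\<And>p. p \<in> Q \<Longrightarrow> card (R p) = 2" and D: "D \<ge> 1"
  shows "real (card {n. n < N \<and> (\<forall>p\<in>Q. n mod p \<notin> R p)})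
     \<le> real N / (\<Sum>S\<in>smooth_sets Q D. \<Prod>p\<in>S. 2 / (real p - 2)) + D ^ 4"
proof -
  define F where "F = smooth_sets Q D"
  \<comment> \<open>\<open>f\<close> is the density of the forbidden classes, and \<open>g\<close>
    is \<open>f / (1 - f)\<close> prime by prime: (2/p) / (1 - 2/p) = 2 / (p - 2).\<close>
  define f where "f S = (\<Prod>p\<in>S. 2 / real p)" for S :: "nat set"
  define g where "g S = (\<Prod>p\<in>S. 2 / (real p - 2))" for S :: "nat set"
  define G where "G = (\<Sum>S\<in>F. g S)"
  \<comment> \<open>Selberg's weights, which diagonalise and minimise the quadratic form below. The crude bound
    \<open>\<bar>lam S\<bar> \<le> 1 / f S\<close> is enough, since \<open>D\<close> is taken to be a small power of \<open>N\<close>.\<close>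
  define lam where "lam S = (-1) ^ card S / (G * f S) * (\<Sum>T\<in>{T\<in>F. S \<subseteq> T}. g T)" for S
  have finF: "finite F" unfolding F_def by (rule finite_smooth_sets[OF fin])
  have Fmono: "S \<in> F" if "T \<in> F" "S \<subseteq> T" for S T
    using smooth_sets_mono[OF _ _ fin pr] that unfolding F_def by blast
  have FQ: "S \<subseteq> Q" if "S \<in> F" for S using that by (auto simp: F_def smooth_sets_def)
  have FD: "real (\<Prod>S) \<le> D" if "S \<in> F" for S using that by (auto simp: F_def smooth_sets_def)
  have finS: "finite S" if "S \<in> F" for S using FQ[OF that] fin finite_subset by blast
  have empF: "{} \<in> F" using D by (simp add: F_def smooth_sets_def)
  have gpos: "g S > 0" if "S \<in> F" for S
    unfolding g_def using FQ[OF that] p2 by (intro prod_pos) (auto simp: subset_iff)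
  have gnn: "g S \<ge> 0" if "S \<in> F" for S using gpos[OF that] by (rule less_imp_le)
  have fpos: "f S > 0" if "S \<subseteq> Q" for S
    unfolding f_def using that pr by (intro prod_pos) (auto simp: subset_iff prime_gt_0_nat)
  have "G \<ge> g {}" unfolding G_def by (rule member_le_sum[where f=g, OF empF gnn finF]) simp
  then have Gpos: "G > 0" by (simp add: g_def)
  \<comment> \<open>The new variables of the diagonalised form. After swapping the sums, the
    alternating sum over \<open>K \<subseteq> S \<subseteq> T\<close> leaves only the term
    \<open>T = K\<close>.\<close>
  have y: "(\<Sum>S\<in>{S\<in>F. K \<subseteq> S}. f S * lam S) = (-1) ^ card K * g K / G" if K: "K \<in> F" for K
  proof -
    have "(\<Sum>S\<in>{S\<in>F. K \<subseteq> S}. f S * lam S) = (\<Sum>S\<in>{S\<in>F. K \<subseteq> S}. (\<Sum>T\<in>{T\<in>F. S \<subseteq> T}. (-1) ^ card S * g T / G))"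
    proof (rule sum.cong[OF refl])
      fix S assume "S \<in> {S\<in>F. K \<subseteq> S}"
      then have "S \<in> F" by simp
      from fpos[OF FQ[OF this]] have "f S \<noteq> 0" by simp
      then show "f S * lam S = (\<Sum>T\<in>{T\<in>F. S \<subseteq> T}. (-1) ^ card S * g T / G)"
        unfolding lam_def by (simp add: sum_distrib_left sum_divide_distrib field_simps)
    qed
    also have "\<dots> = (\<Sum>T\<in>F. (\<Sum>S\<in>{S\<in>{S\<in>F. K \<subseteq> S}. S \<subseteq> T}. (-1) ^ card S * g T / G))"
      by (rule sum.swap_restrict) (use finF in auto)
    also have "\<dots> = (\<Sum>T\<in>F. if K = T then (-1) ^ card K * g T / G else 0)"
    proof (rule sum.cong[OF refl])
      fix T assume T: "T \<in> F"
      show "(\<Sum>S\<in>{S\<in>{S\<in>F. K \<subseteq> S}. S \<subseteq> T}. (-1) ^ card S * g T / G) = (if K = T then (-1) ^ card K * g T / G else 0)"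
      proof (cases "K \<subseteq> T")
        case True
        have "{S\<in>{S\<in>F. K \<subseteq> S}. S \<subseteq> T} = {S. K \<subseteq> S \<and> S \<subseteq> T}" using Fmono[OF T] by auto
        then have "(\<Sum>S\<in>{S\<in>{S\<in>F. K \<subseteq> S}. S \<subseteq> T}. (-1) ^ card S * g T / G) = (\<Sum>S\<in>{S. K \<subseteq> S \<and> S \<subseteq> T}. (-1) ^ card S) * (g T / G)"
          by (simp only: sum_distrib_right) simp
        then show ?thesis using sum_alternating_interval[OF finS[OF T] True] by auto
      next
        case False
        then have "{S\<in>{S\<in>F. K \<subseteq> S}. S \<subseteq> T} = {}" by auto
        then show ?thesis using False by (auto simp del: Collect_empty_eq)
      qed
    qed
    also have "\<dots> = (-1) ^ card K * g K / G" using finF K by (simp add: sum.delta)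
    finally show ?thesis .
  qed
  have lam_empty: "lam {} = 1" unfolding lam_def using Gpos by (simp add: G_def f_def)
  have lam_bd: "\<bar>lam S\<bar> \<le> 1 / f S" if S: "S \<in> F" for S
  proof -
    have "(\<Sum>T\<in>{T\<in>F. S \<subseteq> T}. g T) \<le> G" unfolding G_def
      by (rule sum_mono2[OF finF]) (use gnn in auto)
    moreover have "(\<Sum>T\<in>{T\<in>F. S \<subseteq> T}. g T) \<ge> 0" using gnn by (intro sum_nonneg) auto
    ultimately show ?thesis unfolding lam_def using fpos[OF FQ[OF S]] Gpos
      by (simp add: abs_mult field_simps)
  qed
  \<comment> \<open>This separates \<open>S\<close> from \<open>T\<close>: at a single prime 1 + 1/g
    = p/2 = 1/f, so summing \<open>1 / g K\<close> over the subsets \<open>K\<close> of the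
    intersection gives the inverse of \<open>f\<close> there.\<close>
  have f_lcm: "f (S \<union> T) = f S * f T * (\<Sum>K\<in>{K\<in>F. K \<subseteq> S \<and> K \<subseteq> T}. 1 / g K)" if S: "S \<in> F" and T: "T \<in> F" for S T
  proof -
    have fi: "finite (S \<inter> T)" using finS[OF S] by simp
    have "{K\<in>F. K \<subseteq> S \<and> K \<subseteq> T} = Pow (S \<inter> T)" using Fmono[OF S] by auto
    then have "(\<Sum>K\<in>{K\<in>F. K \<subseteq> S \<and> K \<subseteq> T}. 1 / g K) = (\<Sum>K\<in>Pow (S \<inter> T). \<Prod>p\<in>K. (real p - 2) / 2)"
      by (simp add: g_def prod_dividef)
    also have "\<dots> = (\<Prod>p\<in>S \<inter> T. (real p - 2) / 2 + 1)"
      by (rule prod_add_one[OF fi, symmetric])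
    also have "\<dots> = (\<Prod>p\<in>S \<inter> T. real p / 2)" by (simp add: field_simps)
    also have "\<dots> = inverse (f (S \<inter> T))" by (simp add: f_def prod_dividef)
    finally have e: "(\<Sum>K\<in>{K\<in>F. K \<subseteq> S \<and> K \<subseteq> T}. 1 / g K) = inverse (f (S \<inter> T))" .
    have u: "f (S \<union> T) * f (S \<inter> T) = f S * f T"
      unfolding f_def by (rule prod.union_inter[OF finS[OF S] finS[OF T]])
    have "f (S \<inter> T) > 0" by (rule fpos) (use FQ[OF S] in auto)
    then have "f (S \<union> T) = f (S \<union> T) * f (S \<inter> T) * inverse (f (S \<inter> T))" by simp
    then show ?thesis unfolding u e .
  qed
  \<comment> \<open>With \<open>f_lcm\<close> the form becomes a sum over \<open>K\<close> of
    \<open>1 / g K\<close> times a square, and \<open>y\<close> evaluates the squares: the total is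
    \<open>G / G ^ 2\<close>.\<close>
  have main: "(\<Sum>S\<in>F. \<Sum>T\<in>F. lam S * lam T * f (S \<union> T)) = 1 / G"
  proof -
    have "(\<Sum>S\<in>F. \<Sum>T\<in>F. lam S * lam T * f (S \<union> T))
        = (\<Sum>S\<in>F. \<Sum>T\<in>F. \<Sum>K\<in>F. if K \<subseteq> S \<and> K \<subseteq> T then 1 / g K * (f S * lam S) * (f T * lam T) else 0)"
      by (intro sum.cong refl, simp only: f_lcm sum_distrib_left sum.inter_filter[OF finF], intro sum.cong refl, auto)
    also have "\<dots> = (\<Sum>S\<in>F. \<Sum>K\<in>F. \<Sum>T\<in>F. if K \<subseteq> S \<and> K \<subseteq> T then 1 / g K * (f S * lam S) * (f T * lam T) else 0)"
      by (intro sum.cong refl sum.swap)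
    also have "\<dots> = (\<Sum>K\<in>F. \<Sum>S\<in>F. \<Sum>T\<in>F. if K \<subseteq> S \<and> K \<subseteq> T then 1 / g K * (f S * lam S) * (f T * lam T) else 0)"
      by (rule sum.swap)
    also have "\<dots> = (\<Sum>K\<in>F. 1 / g K * (\<Sum>S\<in>{S\<in>F. K \<subseteq> S}. f S * lam S)\<^sup>2)"
    proof (rule sum.cong[OF refl])
      fix K assume "K \<in> F"
      have "(\<Sum>S\<in>{S\<in>F. K \<subseteq> S}. f S * lam S)\<^sup>2 = (\<Sum>S\<in>F. \<Sum>T\<in>F. (if K \<subseteq> S then f S * lam S else 0) * (if K \<subseteq> T then f T * lam T else 0))"
        by (simp only: power2_eq_square sum_product sum.inter_filter[OF finF])
      then show "(\<Sum>S\<in>F. \<Sum>T\<in>F. if K \<subseteq> S \<and> K \<subseteq> T then 1 / g K * (f S * lam S) * (f T * lam T) else 0) =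
          1 / g K * (\<Sum>S\<in>{S\<in>F. K \<subseteq> S}. f S * lam S)\<^sup>2"
        by (simp only: sum_distrib_left) (intro sum.cong refl, auto)
    qed
    also have "\<dots> = (\<Sum>K\<in>F. g K / G\<^sup>2)"
    proof (rule sum.cong[OF refl])
      fix K assume K: "K \<in> F"
      have "((-1) ^ card K * g K / G)\<^sup>2 = (g K)\<^sup>2 / G\<^sup>2"
        by (simp add: power_divide power_mult_distrib flip: power_mult)
      then show "1 / g K * (\<Sum>S\<in>{S\<in>F. K \<subseteq> S}. f S * lam S)\<^sup>2 = g K / G\<^sup>2"
        using gpos[OF K] by (simp add: y[OF K] power2_eq_square)
    qed
    also have "\<dots> = 1 / G" using Gpos by (simp add: G_def sum_divide_distrib[symmetric] power2_eq_square)
    finally show ?thesis .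
  qed
  define c where "c U = real (card {n. n < N \<and> (\<forall>p\<in>U. n mod p \<in> R p)})" for U
  have cU: "\<bar>c (S \<union> T) - real N * f (S \<union> T)\<bar> \<le> 2 ^ card (S \<union> T)" if S: "S \<in> F" and T: "T \<in> F" for S T
  proof -
    have sub: "S \<union> T \<subseteq> Q" using FQ S T by auto
    have "(\<Prod>p\<in>S \<union> T. real (card (R p)) / real p) = f (S \<union> T)"
      unfolding f_def by (rule prod.cong) (use R2 sub in auto)
    moreover have "(\<Prod>p\<in>S \<union> T. card (R p)) = (\<Prod>p\<in>S \<union> T. 2)"
      by (rule prod.cong) (use R2 sub in auto)
    ultimately show ?thesis
      using card_residue_system_interval[of "S \<union> T" R N] finS[OF S] finS[OF T] sub pr R
      unfolding c_def by (auto simp: subset_iff)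
  qed
  have "real (card {n. n < N \<and> (\<forall>p\<in>Q. n mod p \<notin> R p)}) = (\<Sum>n<N. if \<forall>p\<in>Q. n mod p \<notin> R p then 1 else 0)"
    by (simp add: sum.If_cases lessThan_def Collect_conj_eq)
  \<comment> \<open>At a surviving \<open>n\<close> only the empty set contributes, so the square is
    1; elsewhere it is merely nonnegative.\<close>
  also have "\<dots> \<le> (\<Sum>n<N. (\<Sum>S\<in>F. if \<forall>p\<in>S. n mod p \<in> R p then lam S else 0)\<^sup>2)"
  proof (rule sum_mono)
    fix n
    show "(if \<forall>p\<in>Q. n mod p \<notin> R p then 1 else 0) \<le> (\<Sum>S\<in>F. if \<forall>p\<in>S. n mod p \<in> R p then lam S else 0)\<^sup>2"
    proof (cases "\<forall>p\<in>Q. n mod p \<notin> R p")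
      case True
      have "(\<Sum>S\<in>F. if \<forall>p\<in>S. n mod p \<in> R p then lam S else 0) = (\<Sum>S\<in>F. if S = {} then lam S else 0)"
        by (rule sum.cong) (use True FQ in fastforce)+
      also have "\<dots> = 1" using finF empF lam_empty by (simp add: sum.delta)
      finally show ?thesis by simp
    qed auto
  qed
  also have "\<dots> = (\<Sum>n<N. \<Sum>S\<in>F. \<Sum>T\<in>F. if \<forall>p\<in>S \<union> T. n mod p \<in> R p then lam S * lam T else 0)"
    unfolding power2_eq_square sum_product by (intro sum.cong refl) auto
  also have "\<dots> = (\<Sum>S\<in>F. \<Sum>n<N. \<Sum>T\<in>F. if \<forall>p\<in>S \<union> T. n mod p \<in> R p then lam S * lam T else 0)"
    by (rule sum.swap)
  also have "\<dots> = (\<Sum>S\<in>F. \<Sum>T\<in>F. \<Sum>n<N. if \<forall>p\<in>S \<union> T. n mod p \<in> R p then lam S * lam T else 0)"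
    by (intro sum.cong refl sum.swap)
  also have "\<dots> = (\<Sum>S\<in>F. \<Sum>T\<in>F. lam S * lam T * c (S \<union> T))"
    by (simp add: sum.If_cases c_def lessThan_def Collect_conj_eq mult.commute)
  also have "\<dots> \<le> (\<Sum>S\<in>F. \<Sum>T\<in>F. lam S * lam T * f (S \<union> T) * real N + D\<^sup>2)"
  proof (intro sum_mono)
    fix S T assume S: "S \<in> F" and T: "T \<in> F"
    have fS: "1 / f S = real (\<Prod>S) / 2 ^ card S" for S :: "nat set"
      by (simp add: f_def prod_dividef)
    \<comment> \<open>The powers of 2 hidden in \<open>1 / f\<close> cancel the error
      \<open>2 ^ card (S \<union> T)\<close> of the count; what remains is a product of two integers
      up to \<open>D\<close>.\<close>
    have "\<bar>lam S * lam T\<bar> * \<bar>c (S \<union> T) - real N * f (S \<union> T)\<bar> \<le> (1 / f S * (1 / f T)) * 2 ^ card (S \<union> T)"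
      unfolding abs_mult using fpos[OF FQ[OF S]] fpos[OF FQ[OF T]]
      by (intro mult_mono lam_bd cU S T mult_nonneg_nonneg) auto
    also have "\<dots> = (real (\<Prod>S) * real (\<Prod>T)) * (2 ^ card (S \<union> T) / (2 ^ card S * 2 ^ card T))"
      unfolding fS by simp
    also have "\<dots> \<le> (D * D) * 1"
    proof (intro mult_mono FD S T)
      have "card (S \<union> T) \<le> card S + card T" by (rule card_Un_le)
      then have "(2::real) ^ card (S \<union> T) \<le> 2 ^ (card S + card T)" by (rule power_increasing) simp
      then show "(2::real) ^ card (S \<union> T) / (2 ^ card S * 2 ^ card T) \<le> 1" by (simp add: power_add)
    qed (use D in \<open>auto intro: prod_nonneg\<close>)
    finally have "\<bar>lam S * lam T * (c (S \<union> T) - real N * f (S \<union> T))\<bar> \<le> D\<^sup>2"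
      by (simp add: abs_mult power2_eq_square)
    then have "lam S * lam T * (c (S \<union> T) - real N * f (S \<union> T)) \<le> D\<^sup>2" by linarith
    then show "lam S * lam T * c (S \<union> T) \<le> lam S * lam T * f (S \<union> T) * real N + D\<^sup>2"
      by (simp add: algebra_simps)
  qed
  also have "\<dots> = (1 / G) * real N + (real (card F))\<^sup>2 * D\<^sup>2"
    unfolding main[symmetric] by (simp add: sum.distrib sum_distrib_right power2_eq_square)
  also have "\<dots> \<le> (1 / G) * real N + D\<^sup>2 * D\<^sup>2"
  proof -
    have "real (card F) \<le> D" unfolding F_def using card_smooth_sets[OF fin pr] D by simp
    then show ?thesis by (intro add_left_mono mult_right_mono power_mono) auto
  qed
  finally show ?thesis unfolding G_def F_def g_def by (simp flip: power_add)
qed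

subsection \<open>Lower bound for the sieve denominator\<close>

lemma sum_inverse_powers:
  assumes "p > (1::real)"
  shows "(\<Sum>j=1..J. 1 / p ^ j) \<le> 1 / (p - 1)"
proof -
  have "(\<Sum>j=1..J. 1 / p ^ j) = (1 - 1 / p ^ J) / (p - 1)"
  proof (induction J)
    case (Suc J)
    have "p ^ J > 0" using assms by simp
    then have "(1 - 1 / p ^ J) / (p - 1) + 1 / (p * p ^ J) = (1 - 1 / (p * p ^ J)) / (p - 1)"
      using assms by (simp add: divide_simps) (simp add: algebra_simps)
    then show ?case using Suc by simp
  qed simp
  also have "\<dots> \<le> 1 / (p - 1)" using assms by (intro divide_right_mono) auto
  finally show ?thesis .
qed

lemma prod_prime_weight_nonneg:
  assumes "\<And>p. p \<in> S \<Longrightarrow> prime (p::nat)"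
  shows "(\<Prod>p\<in>S. 1 / (real p - 1)) \<ge> 0"
proof (rule prod_nonneg)
  fix p assume "p \<in> S"
  then have "p > 1" using assms prime_gt_1_nat by blast
  then show "1 / (real p - 1) \<ge> 0" by simp
qed

text \<open>An Euler product: each factor is the geometric series of \<open>1 / p ^ j\<close> over
  \<open>j \<ge> 1\<close>, so the product expands into all integers with prime support
  \<open>S\<close>. The induction splits off the exact power of one prime.\<close>

lemma sum_inverse_fixed_prime_factors:
  assumes "finite S" "\<And>p. p \<in> S \<Longrightarrow> prime p" "finite M" "\<And>m. m \<in> M \<Longrightarrow> m > 0 \<and> prime_factors m = (S::nat set)"
  shows "(\<Sum>m\<in>M. 1 / real m) \<le> (\<Prod>p\<in>S. 1 / (real p - 1))"
  using assms
proof (induction S arbitrary: M rule: finite_induct)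
  case empty
  have "M \<subseteq> {1}" using empty(3) by (auto simp: prime_factorization_empty_iff)
  then have "M = {} \<or> M = {1}" by auto
  then show ?case by auto
next
  case (insert p S)
  have pp: "prime p" using insert.prems(1) by simp
    define k where "k m = multiplicity p m" for m
    define r where "r m = m div p ^ k m" for m
    have dec: "m = p ^ k m * r m" "\<not> p dvd r m" "r m > 0" "prime_factors (r m) = S" "k m \<ge> 1" if m: "m \<in> M" for m
    proof -
      have m0: "m > 0" "prime_factors m = insert p S" using insert.prems(3)[OF m] by auto
      show 1: "m = p ^ k m * r m" unfolding r_def k_def by (simp add: multiplicity_dvd)
      show 3: "r m > 0" using 1 m0 by (metis gr0I mult_0_right less_irrefl)
      show 2: "\<not> p dvd r m" unfolding r_def k_def
        using m0 pp by (intro multiplicity_decompose) auto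
      have "p dvd m" using m0 by (metis in_prime_factors_imp_dvd insertI1)
      then show 5: "k m \<ge> 1" unfolding k_def
        by (metis m0(1) multiplicity_gt_zero_iff not_prime_unit pp One_nat_def Suc_leI gr_implies_not0)
      have "prime_factors m = prime_factors (p ^ k m) \<union> prime_factors (r m)"
        by (subst 1, rule prime_factors_product) (use 3 pp in auto)
      also have "prime_factors (p ^ k m) = {p}"
        using 5 pp by (subst prime_factors_power) (auto simp: prime_prime_factors)
      finally have "insert p S = insert p (prime_factors (r m))" using m0 by simp
      moreover have "p \<notin> prime_factors (r m)" using 2 by auto
      ultimately show "prime_factors (r m) = S" using insert.hyps by (metis insert_ident)
    qed
    define J where "J = Max (k ` M)"
    have inj: "inj_on (\<lambda>m. (k m, r m)) M"
      by (rule inj_onI) (metis dec(1) prod.inject)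
    have "(\<Sum>m\<in>M. 1 / real m) = (\<Sum>m\<in>M. 1 / real p ^ k m * (1 / real (r m)))"
      by (rule sum.cong[OF refl]) (metis dec(1) of_nat_mult of_nat_power divide_divide_eq_left mult.right_neutral times_divide_eq_right)
    also have "\<dots> = (\<Sum>(j, m)\<in>(\<lambda>m. (k m, r m)) ` M. 1 / real p ^ j * (1 / real m))"
      using inj by (simp add: sum.reindex)
    also have "\<dots> \<le> (\<Sum>(j, m)\<in>{1..J} \<times> r ` M. 1 / real p ^ j * (1 / real m))"
    proof (rule sum_mono2)
      show "(\<lambda>m. (k m, r m)) ` M \<subseteq> {1..J} \<times> r ` M"
        using insert.prems(2) dec(5) by (auto simp: J_def)
    qed (use insert.prems(2) in auto)
    also have "\<dots> = (\<Sum>j=1..J. 1 / real p ^ j) * (\<Sum>m\<in>r ` M. 1 / real m)"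
      by (simp add: sum_product sum.cartesian_product)
    also have "\<dots> \<le> (1 / (real p - 1)) * (\<Prod>p\<in>S. 1 / (real p - 1))"
    proof (rule mult_mono)
      show "(\<Sum>j=1..J. 1 / real p ^ j) \<le> 1 / (real p - 1)"
        by (rule sum_inverse_powers) (use pp prime_gt_1_nat in auto)
      show "(\<Sum>m\<in>r ` M. 1 / real m) \<le> (\<Prod>p\<in>S. 1 / (real p - 1))"
        by (rule insert.IH) (use insert.prems(1,2) dec in auto)
    qed (use pp prime_gt_1_nat in \<open>auto intro!: sum_nonneg simp: less_imp_le\<close>)
    finally show ?case using insert.hyps by simp
qed

lemma Prod_prime_factors_le:
  assumes "m > (0::nat)"
  shows "\<Prod>(prime_factors m) \<le> m"
proof -
  have "(\<Prod>p\<in>prime_factors m. p) dvd (\<Prod>p\<in>prime_factors m. p ^ multiplicity p m)"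
    by (rule prod_dvd_prod) (auto simp: prime_factors_multiplicity intro!: dvd_power)
  then have "\<Prod>(prime_factors m) dvd m"
    using prime_factorization_nat[OF assms] by simp
  then show ?thesis using assms by (rule dvd_imp_le)
qed

text \<open>The harmonic sum up to \<open>y\<close> is grouped by the set of prime factors of
  \<open>m\<close>; its product is at most \<open>m\<close>, hence at most \<open>y\<close>.\<close>

lemma ln_le_sum_smooth_sets:
  assumes y: "y \<ge> 1" and fin: "finite P" and P: "\<And>p. prime p \<Longrightarrow> real p \<le> y \<Longrightarrow> p \<in> P"
    and pr: "\<And>p. p \<in> P \<Longrightarrow> prime p"
  shows "ln y \<le> (\<Sum>S\<in>smooth_sets P y. \<Prod>p\<in>S. 1 / (real p - 1))"
proof -
  define M where "M = {1..nat \<lfloor>y\<rfloor>}"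
  have "ln y \<le> ln (real (nat \<lfloor>y\<rfloor>) + 1)" using y by (subst ln_le_cancel_iff) (auto, linarith)
  also have "\<dots> \<le> harm (nat \<lfloor>y\<rfloor>)" by (rule ln_le_harm)
  also have "\<dots> = (\<Sum>m\<in>M. 1 / real m)" by (simp add: harm_def M_def divide_inverse)
  also have "\<dots> = (\<Sum>S\<in>prime_factors ` M. \<Sum>m\<in>{m\<in>M. prime_factors m = S}. 1 / real m)"
    by (rule sum.image_gen) (simp add: M_def)
  also have "\<dots> \<le> (\<Sum>S\<in>prime_factors ` M. \<Prod>p\<in>S. 1 / (real p - 1))"
    by (rule sum_mono, rule sum_inverse_fixed_prime_factors) (auto simp: M_def)
  also have "\<dots> \<le> (\<Sum>S\<in>smooth_sets P y. \<Prod>p\<in>S. 1 / (real p - 1))"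
  proof (rule sum_mono2[OF finite_smooth_sets[OF fin]])
    show "prime_factors ` M \<subseteq> smooth_sets P y"
    proof (rule image_subsetI)
      fix m assume m: "m \<in> M"
      then have m0: "m > 0" "real m \<le> y" using y by (auto simp: M_def le_nat_iff le_floor_iff)
      have "real (\<Prod>(prime_factors m)) \<le> real m" using Prod_prime_factors_le[OF m0(1)] by (simp only: of_nat_le_iff)
      moreover have "p \<in> P" if "p \<in> prime_factors m" for p
      proof (rule P)
        show "prime p" using that by auto
        have "p \<le> m" using that m0 by (auto intro: dvd_imp_le)
        then show "real p \<le> y" using m0 by linarith
      qed
      ultimately show "prime_factors m \<in> smooth_sets P y" using m0 unfolding smooth_sets_def
        by (intro CollectI conjI subsetI) (auto simp del: of_nat_prod)
    qed
    fix S assume "S \<in> smooth_sets P y - prime_factors ` M"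
    then show "(\<Prod>p\<in>S. 1 / (real p - 1)) \<ge> 0"
      by (intro prod_prime_weight_nonneg) (use pr in \<open>auto simp: smooth_sets_def\<close>)
  qed
  finally show ?thesis .
qed

text \<open>This is \<open>n / \<phi>(n)\<close>; its square plays the role of the singular series.\<close>

definition phi_ratio :: "nat \<Rightarrow> real" where
  "phi_ratio n = (\<Prod>p\<in>prime_factors n. 1 + 1 / (real p - 1))"

text \<open>The price of not sieving by the primes of \<open>K\<close>: splitting \<open>S\<close>
  into its parts inside and outside those primes bounds the sum by a product whose first factor
  expands to \<open>phi_ratio K\<close>.\<close>

lemma sum_smooth_sets_coprime:
  fixes K :: nat
  assumes fin: "finite P" and pr: "\<And>p. p \<in> P \<Longrightarrow> prime p"
  shows "(\<Sum>S\<in>smooth_sets P y. \<Prod>p\<in>S. 1 / (real p - 1))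
      \<le> phi_ratio K * (\<Sum>S\<in>smooth_sets (P - prime_factors K) y. \<Prod>p\<in>S. 1 / (real p - 1))"
proof -
  let ?g = "\<lambda>S. \<Prod>p\<in>S. 1 / (real p - 1)"
  let ?K = "prime_factors K"
  have finS: "finite S" if "S \<in> smooth_sets P y" for S
    using that fin by (auto simp: smooth_sets_def intro: finite_subset)
  have inj: "inj_on (\<lambda>S. (S \<inter> ?K, S - ?K)) (smooth_sets P y)"
    by (rule inj_onI) (metis Un_Diff_Int prod.inject Un_commute)
  note gnn = prod_prime_weight_nonneg
  have "(\<Sum>S\<in>smooth_sets P y. ?g S) = (\<Sum>S\<in>smooth_sets P y. ?g (S \<inter> ?K) * ?g (S - ?K))"
    by (rule sum.cong[OF refl]) (simp add: prod.Int_Diff[OF finS])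
  also have "\<dots> = (\<Sum>(U, V)\<in>(\<lambda>S. (S \<inter> ?K, S - ?K)) ` smooth_sets P y. ?g U * ?g V)"
    using inj by (simp add: sum.reindex)
  also have "\<dots> \<le> (\<Sum>(U, V)\<in>Pow ?K \<times> smooth_sets (P - ?K) y. ?g U * ?g V)"
  proof (rule sum_mono2)
    show "finite (Pow ?K \<times> smooth_sets (P - ?K) y)" using fin by (simp add: finite_smooth_sets)
    have "S - ?K \<in> smooth_sets P y" if "S \<in> smooth_sets P y" for S
      by (rule smooth_sets_mono[OF that _ fin pr]) auto
    then show "(\<lambda>S. (S \<inter> ?K, S - ?K)) ` smooth_sets P y \<subseteq> Pow ?K \<times> smooth_sets (P - ?K) y"
      by (auto simp: smooth_sets_def)
    fix z assume z: "z \<in> Pow ?K \<times> smooth_sets (P - ?K) y - (\<lambda>S. (S \<inter> ?K, S - ?K)) ` smooth_sets P y"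
    obtain U V where UV: "z = (U, V)" by (cases z)
    have U: "U \<subseteq> ?K" and V: "V \<subseteq> P" using DiffD1[OF z] unfolding UV smooth_sets_def by blast+
    have "?g U \<ge> 0" by (rule gnn) (use U in blast)
    moreover have "?g V \<ge> 0" by (rule gnn) (use V pr in blast)
    ultimately show "(case z of (U, V) \<Rightarrow> ?g U * ?g V) \<ge> 0" using UV by simp
  qed
  also have "\<dots> = (\<Sum>U\<in>Pow ?K. ?g U) * (\<Sum>V\<in>smooth_sets (P - ?K) y. ?g V)"
    by (simp add: sum_product sum.cartesian_product)
  also have "(\<Sum>U\<in>Pow ?K. ?g U) = phi_ratio K"
    unfolding phi_ratio_def by (subst prod_add_one[symmetric]) (auto simp: add.commute)
  finally show ?thesis .
qed

text \<open>Each \<open>p\<close> in \<open>U\<close> lies in \<open>S\<close> only, in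
  \<open>T\<close> only or in both, with weights \<open>a\<close>, \<open>a\<close> and
  \<open>a ^ 2\<close>. The proof encodes \<open>T\<close> by its intersection with
  \<open>S\<close>.\<close>

lemma sum_Un_eq_prod:
  fixes a :: "'a \<Rightarrow> real"
  assumes fin: "finite U"
  shows "(\<Sum>(S, T)\<in>{(S, T). S \<union> T = U}. (\<Prod>p\<in>S. a p) * (\<Prod>p\<in>T. a p)) = (\<Prod>p\<in>U. 2 * a p + (a p)\<^sup>2)"
proof -
  have "(\<Sum>(S, T)\<in>{(S, T). S \<union> T = U}. (\<Prod>p\<in>S. a p) * (\<Prod>p\<in>T. a p))
      = (\<Sum>(S, V)\<in>(SIGMA S:Pow U. Pow S). (\<Prod>p\<in>S. a p) * ((\<Prod>p\<in>U - S. a p) * (\<Prod>p\<in>V. a p)))"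
  proof (rule sum.reindex_bij_witness[where i = "\<lambda>(S, V). (S, (U - S) \<union> V)" and j = "\<lambda>(S, T). (S, S \<inter> T)"])
    fix z assume "z \<in> {(S, T). S \<union> T = U}"
    then obtain S T where z: "z = (S, T)" "S \<union> T = U" by auto
    have "T = (U - S) \<union> (S \<inter> T)" using z by auto
    then have "(\<Prod>p\<in>T. a p) = (\<Prod>p\<in>(U - S) \<union> (S \<inter> T). a p)" by simp
    also have "\<dots> = (\<Prod>p\<in>U - S. a p) * (\<Prod>p\<in>S \<inter> T. a p)"
      by (rule prod.union_disjoint) (use fin z in \<open>auto intro: finite_subset\<close>)
    finally show "(case (case z of (S, T) \<Rightarrow> (S, S \<inter> T)) of (S, V) \<Rightarrow> (\<Prod>p\<in>S. a p) * ((\<Prod>p\<in>U - S. a p) * (\<Prod>p\<in>V. a p)))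
        = (case z of (S, T) \<Rightarrow> (\<Prod>p\<in>S. a p) * (\<Prod>p\<in>T. a p))"
      using z by simp
  qed auto
  also have "\<dots> = (\<Sum>S\<in>Pow U. \<Sum>V\<in>Pow S. (\<Prod>p\<in>S. a p) * ((\<Prod>p\<in>U - S. a p) * (\<Prod>p\<in>V. a p)))"
    by (rule sum.Sigma[symmetric]) (use fin in \<open>auto intro: finite_subset\<close>)
  also have "\<dots> = (\<Sum>S\<in>Pow U. (\<Prod>p\<in>S. a p * (a p + 1)) * (\<Prod>p\<in>U - S. a p))"
  proof (rule sum.cong[OF refl])
    fix S assume "S \<in> Pow U"
    then have "finite S" using fin finite_subset by auto
    from prod_add_one[OF this, of a]
    show "(\<Sum>V\<in>Pow S. (\<Prod>p\<in>S. a p) * ((\<Prod>p\<in>U - S. a p) * (\<Prod>p\<in>V. a p))) = (\<Prod>p\<in>S. a p * (a p + 1)) * (\<Prod>p\<in>U - S. a p)"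
      by (simp add: prod.distrib sum_distrib_left[symmetric])
  qed
  also have "\<dots> = (\<Prod>p\<in>U. a p * (a p + 1) + a p)"
    by (rule prod_add[OF fin, symmetric])
  also have "\<dots> = (\<Prod>p\<in>U. 2 * a p + (a p)\<^sup>2)"
    by (rule prod.cong) (auto simp: algebra_simps power2_eq_square)
  finally show ?thesis .
qed

text \<open>Reduces the two-dimensional sieve denominator to a one-dimensional sum, for which the
  logarithm is a lower bound. Pairs are grouped by their union, which squares the level, and prime
  by prime 2/(p-1) + 1/(p-1)^2 <= 2/(p-2).\<close>

lemma sum_smooth_sets_square_le:
  assumes fin: "finite Q" and pr: "\<And>p. p \<in> Q \<Longrightarrow> prime p" and p2: "\<And>p. p \<in> Q \<Longrightarrow> p > 2" and y: "y \<ge> 0"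
  shows "(\<Sum>S\<in>smooth_sets Q y. \<Prod>p\<in>S. 1 / (real p - 1))\<^sup>2 \<le> (\<Sum>S\<in>smooth_sets Q (y\<^sup>2). \<Prod>p\<in>S. 2 / (real p - 2))"
proof -
  let ?g = "\<lambda>S. \<Prod>p\<in>S. 1 / (real p - 1)"
  let ?A = "smooth_sets Q y"
  have finA: "finite ?A" by (rule finite_smooth_sets[OF fin])
  have AQ: "S \<subseteq> Q" if "S \<in> ?A" for S using that by (auto simp: smooth_sets_def)
  have gnn: "?g S \<ge> 0" if "S \<subseteq> Q" for S
    by (rule prod_prime_weight_nonneg) (use that pr in auto)
  have "(\<Sum>S\<in>?A. ?g S)\<^sup>2 = (\<Sum>(S, T)\<in>?A \<times> ?A. ?g S * ?g T)"
    by (simp add: power2_eq_square sum_product sum.cartesian_product)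
  also have "\<dots> = (\<Sum>U\<in>(\<lambda>(S, T). S \<union> T) ` (?A \<times> ?A). \<Sum>(S, T)\<in>{z\<in>?A \<times> ?A. (\<lambda>(S, T). S \<union> T) z = U}. ?g S * ?g T)"
    by (rule sum.image_gen) (simp add: finA)
  also have "\<dots> \<le> (\<Sum>U\<in>(\<lambda>(S, T). S \<union> T) ` (?A \<times> ?A). \<Prod>p\<in>U. 2 / (real p - 2))"
  proof (rule sum_mono)
    fix U assume "U \<in> (\<lambda>(S, T). S \<union> T) ` (?A \<times> ?A)"
    then have UQ: "U \<subseteq> Q" using AQ by auto
    have finU: "finite U" using UQ fin finite_subset by blast
    have "(\<Sum>(S, T)\<in>{z\<in>?A \<times> ?A. (\<lambda>(S, T). S \<union> T) z = U}. ?g S * ?g T) \<le> (\<Sum>(S, T)\<in>{(S, T). S \<union> T = U}. ?g S * ?g T)"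
    proof (rule sum_mono2)
      have "{(S, T). S \<union> T = U} \<subseteq> Pow U \<times> Pow U" by auto
      then show "finite {(S, T). S \<union> T = U}" by (rule finite_subset) (use finU in auto)
      fix z assume "z \<in> {(S, T). S \<union> T = U} - {z\<in>?A \<times> ?A. (\<lambda>(S, T). S \<union> T) z = U}"
      then obtain S T where z: "z = (S, T)" "S \<union> T = U" by auto
      then have "?g S \<ge> 0" "?g T \<ge> 0" using gnn UQ by auto
      then show "(case z of (S, T) \<Rightarrow> ?g S * ?g T) \<ge> 0" using z by simp
    qed auto
    also have "\<dots> = (\<Prod>p\<in>U. 2 * (1 / (real p - 1)) + (1 / (real p - 1))\<^sup>2)"
      by (rule sum_Un_eq_prod[OF finU])
    also have "\<dots> \<le> (\<Prod>p\<in>U. 2 / (real p - 2))"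
    proof (rule prod_mono)
      fix p assume "p \<in> U"
      then have p: "real p > 2" using p2 UQ by auto
      define x where "x = real p - 1"
      have x: "x > 1" "real p = x + 1" using p by (auto simp: x_def)
      have "2 * (1 / x) + (1 / x)\<^sup>2 = (2 * x + 1) / x\<^sup>2"
        using x by (simp add: field_simps power2_eq_square)
      also have "\<dots> \<le> 2 / (x - 1)"
        using x by (simp add: divide_simps) (simp add: algebra_simps power2_eq_square)
      finally have "2 * (1 / x) + (1 / x)\<^sup>2 \<le> 2 / (x - 1)" .
      then show "0 \<le> 2 * (1 / (real p - 1)) + (1 / (real p - 1))\<^sup>2 \<and> 2 * (1 / (real p - 1)) + (1 / (real p - 1))\<^sup>2 \<le> 2 / (real p - 2)"
        using x by simp
    qed
    finally show "(\<Sum>(S, T)\<in>{z\<in>?A \<times> ?A. (\<lambda>(S, T). S \<union> T) z = U}. ?g S * ?g T) \<le> (\<Prod>p\<in>U. 2 / (real p - 2))" .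
  qed
  also have "\<dots> \<le> (\<Sum>S\<in>smooth_sets Q (y\<^sup>2). \<Prod>p\<in>S. 2 / (real p - 2))"
  proof (rule sum_mono2[OF finite_smooth_sets[OF fin]])
    show "(\<lambda>(S, T). S \<union> T) ` (?A \<times> ?A) \<subseteq> smooth_sets Q (y\<^sup>2)"
    proof clarify
      fix S T assume S: "S \<in> ?A" and T: "T \<in> ?A"
      have fS: "finite S" "finite T" using AQ S T fin finite_subset by blast+
      have "\<Prod>(S \<inter> T) > 0" using AQ[OF S] pr by (intro prod_pos) (auto simp: prime_gt_0_nat subset_iff)
      moreover have "\<Prod>(S \<union> T) * \<Prod>(S \<inter> T) = \<Prod>S * \<Prod>T" by (rule prod.union_inter[OF fS])
      ultimately have "\<Prod>(S \<union> T) \<le> \<Prod>S * \<Prod>T" 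
        by (metis One_nat_def Suc_leI mult.right_neutral mult_le_mono2)
      then have "real (\<Prod>(S \<union> T)) \<le> real (\<Prod>S) * real (\<Prod>T)" by (metis of_nat_le_iff of_nat_mult)
      also have "\<dots> \<le> y * y" using S T y by (intro mult_mono) (auto simp: smooth_sets_def prod_nonneg)
      finally show "S \<union> T \<in> smooth_sets Q (y\<^sup>2)"
        using AQ S T by (simp add: smooth_sets_def power2_eq_square)
    qed
    fix S assume "S \<in> smooth_sets Q (y\<^sup>2) - (\<lambda>(S, T). S \<union> T) ` (?A \<times> ?A)"
    then have "S \<subseteq> Q" by (auto simp: smooth_sets_def)
    then show "(\<Prod>p\<in>S. 2 / (real p - 2)) \<ge> 0"
      by (intro prod_nonneg divide_nonneg_nonneg) (auto simp: subset_iff dest!: p2)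
  qed
  finally show ?thesis .
qed

subsection \<open>Prime values of two linear forms\<close>

lemma phi_ratio_ge_1: "phi_ratio n \<ge> 1"
  unfolding phi_ratio_def
proof (rule prod_ge_1)
  fix p assume "p \<in> prime_factors n"
  then have "p > 1" using prime_gt_1_nat by auto
  then show "1 + 1 / (real p - 1) \<ge> 1" by simp
qed

lemma phi_ratio_mono:
  assumes "m dvd n" "n > 0"
  shows "phi_ratio m \<le> phi_ratio n"
proof -
  have sub: "prime_factors m \<subseteq> prime_factors n" using assms by (intro dvd_prime_factors) auto
  have ge: "1 + 1 / (real p - 1) \<ge> 1" if "p \<in> prime_factors n" for p
  proof -
    have "p > 1" using prime_gt_1_nat that by auto
    then show ?thesis by simp
  qed
  have "phi_ratio n = phi_ratio m * (\<Prod>p\<in>prime_factors n - prime_factors m. 1 + 1 / (real p - 1))"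
    unfolding phi_ratio_def by (subst prod.subset_diff[OF sub]) (auto simp: mult.commute)
  moreover have "(\<Prod>p\<in>prime_factors n - prime_factors m. 1 + 1 / (real p - 1)) \<ge> 1"
    by (rule prod_ge_1) (use ge in blast)
  moreover have "phi_ratio m \<ge> 0" using phi_ratio_ge_1[of m] by simp
  ultimately show ?thesis by (metis mult.right_neutral mult_left_mono)
qed

lemma phi_ratio_mult_le:
  assumes "m > 0" "n > 0"
  shows "phi_ratio (m * n) \<le> phi_ratio m * phi_ratio n"
proof -
  let ?h = "\<lambda>p. 1 + 1 / (real p - 1)"
  have ge: "?h p \<ge> 1" if "p \<in> prime_factors k" for p k
  proof -
    have "p > 1" using prime_gt_1_nat that by auto
    then show ?thesis by simp
  qed
  have "prime_factors (m * n) = prime_factors m \<union> prime_factors n"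
    using assms by (intro prime_factors_product) auto
  then have "phi_ratio (m * n) * (\<Prod>p\<in>prime_factors m \<inter> prime_factors n. ?h p) = phi_ratio m * phi_ratio n"
    unfolding phi_ratio_def by (simp add: prod.union_inter)
  moreover have "(\<Prod>p\<in>prime_factors m \<inter> prime_factors n. ?h p) \<ge> 1"
    by (rule prod_ge_1) (use ge in blast)
  moreover have "phi_ratio (m * n) \<ge> 0" using phi_ratio_ge_1[of "m * n"] by simp
  ultimately show ?thesis by (metis mult.right_neutral mult_left_mono)
qed

lemma phi_ratio_prime_power_le:
  assumes "prime p"
  shows "phi_ratio (p ^ k) \<le> 2"
proof (cases "k = 0")
  case True
  then show ?thesis by (simp add: phi_ratio_def)
next
  case False
  then have "prime_factors (p ^ k) = {p}"
    using assms by (simp add: prime_factors_power prime_prime_factors)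
  moreover have "real p \<ge> 2" using prime_ge_2_nat[OF assms] by simp
  ultimately show ?thesis by (simp add: phi_ratio_def)
qed

lemma linear_form_root:
  fixes a b p :: nat
  assumes "prime p" "\<not> p dvd a"
  obtains r where "r < p" "\<And>n. p dvd a * n + b \<longleftrightarrow> n mod p = r"
proof -
  have cop: "coprime a p" using assms prime_imp_coprime coprime_commute by metis
  obtain x where x: "[a * x = 1] (mod p)" using cong_solve_coprime_nat[OF cop] by auto
  \<comment> \<open>Here \<open>p - 1\<close> stands for -1 modulo \<open>p\<close>, so
    \<open>s\<close> is -b/a without subtraction.\<close>
  define s where "s = x * (b * (p - 1))"
  have p1: "p \<ge> 1" using prime_gt_1_nat[OF assms(1)] by simp
  have "[a * s + b = (a * x) * (b * (p - 1)) + b] (mod p)" by (simp add: s_def mult_ac)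
  also have "[(a * x) * (b * (p - 1)) + b = 1 * (b * (p - 1)) + b] (mod p)"
    using x by (intro cong_add cong_mult) auto
  also have "1 * (b * (p - 1)) + b = b * p" using p1 by (simp add: algebra_simps flip: distrib_left)
  finally have s: "p dvd a * s + b" by (simp add: cong_def mod_eq_0_iff_dvd)
  show thesis
  proof (rule that[of "s mod p"])
    show "s mod p < p" using p1 by simp
    fix n
    have "p dvd a * n + b \<longleftrightarrow> [a * n + b = a * s + b] (mod p)"
      using s by (metis cong_0_iff cong_dvd_iff cong_sym cong_trans)
    also have "\<dots> \<longleftrightarrow> [a * n = a * s] (mod p)" by (simp add: cong_add_rcancel_nat)
    also have "\<dots> \<longleftrightarrow> [n = s] (mod p)" using cop by (simp add: cong_mult_lcancel_nat)
    finally show "p dvd a * n + b \<longleftrightarrow> n mod p = s mod p" by (simp add: cong_def)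
  qed
qed

text \<open>The modulus \<open>K\<close> collects all primes at which the two linear forms
  do not have two distinct roots; these primes are simply not sieved by.\<close>

theorem card_prime_pairs_le:
  fixes a b c d N :: nat
  defines "K \<equiv> 2 * a * c * nat \<bar>int a * int d - int b * int c\<bar>"
  assumes K0: "K > 0" and N: "N \<ge> 2"
  shows "real (card {n. n < N \<and> prime (a * n + b) \<and> prime (c * n + d)})
           \<le> 700 * real N / (ln (real N))\<^sup>2 * (phi_ratio K)\<^sup>2"
proof -
  have ac: "a > 0" "c > 0" using K0 by (auto simp: K_def)
  \<comment> \<open>The sieve error \<open>D ^ 4\<close> is then N^(1/3), well below the main term.
    \<open>y\<close> is the square root of \<open>D\<close>, as squaring the one-dimensional sum
    squares its level.\<close>
  define D where "D = real N powr (1/12)"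
  define y where "y = real N powr (1/24)"
  have N1: "real N > 1" using N by simp
  have y1: "y \<ge> 1" and D1: "D \<ge> 1" using N1 by (auto simp: y_def D_def ge_one_powr_ge_zero)
  have yD: "y\<^sup>2 = D" using N1 by (simp add: y_def D_def powr_power)
  have "y \<le> D" unfolding y_def D_def using N1 by (intro powr_mono) auto
  have lny: "ln y = ln (real N) / 24" using N1 by (simp add: y_def ln_powr)
  have lnN: "ln (real N) > 0" using N1 by simp
  define P where "P = {p. prime p \<and> real p \<le> D}"
  have finP: "finite P" 
  proof (rule finite_subset)
    show "P \<subseteq> {..nat \<lfloor>D\<rfloor>}" by (auto simp: P_def le_nat_floor)
  qed simp
  define Q where "Q = P - prime_factors K"
  have finQ: "finite Q" using finP by (simp add: Q_def)
  have prQ: "prime p" and QD: "real p \<le> D" and QK: "\<not> p dvd K" if "p \<in> Q" for p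
    using that K0 by (auto simp: Q_def P_def in_prime_factors_iff)
  have Q2: "p > 2" if "p \<in> Q" for p
  proof -
    have "p \<noteq> 2" using QK[OF that] by (auto simp: K_def)
    then show ?thesis using prime_ge_2_nat[OF prQ[OF that]] by simp
  qed
  define R where "R p = {r. r < p \<and> (p dvd a * r + b \<or> p dvd c * r + d)}" for p
  have Rsub: "R p \<subseteq> {..<p}" for p by (auto simp: R_def)
  have Rmod: "n mod p \<in> R p \<longleftrightarrow> p dvd a * n + b \<or> p dvd c * n + d" and Rcard: "card (R p) = 2" if p: "p \<in> Q" for p n
  proof -
    have "\<not> p dvd a" "\<not> p dvd c" using QK[OF p] by (auto simp: K_def)
    then obtain r s where r: "r < p" "\<And>n. p dvd a * n + b \<longleftrightarrow> n mod p = r"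
      and s: "s < p" "\<And>n. p dvd c * n + d \<longleftrightarrow> n mod p = s"
      using linear_form_root[OF prQ[OF p]] by metis
    \<comment> \<open>A common root modulo \<open>p\<close> would make \<open>p\<close> divide the
      determinant of the two forms, which is a factor of \<open>K\<close>.\<close>
    have "r \<noteq> s"
    proof
      assume "r = s"
      then have "p dvd a * r + b" "p dvd c * r + d" using r s by auto
      then have "int p dvd int a * int r + int b" "int p dvd int c * int r + int d"
        by (metis of_nat_add of_nat_mult int_dvd_int_iff)+
      then have "int p dvd int a * (int c * int r + int d) - int c * (int a * int r + int b)"
        by (intro dvd_diff dvd_mult)
      also have "int a * (int c * int r + int d) - int c * (int a * int r + int b) = int a * int d - int b * int c"
        by (simp add: algebra_simps)
      finally have "p dvd nat \<bar>int a * int d - int b * int c\<bar>" by (simp add: nat_abs_dvd_iff dvd_nat_abs_iff)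
      then show False using QK[OF p] by (simp add: K_def)
    qed
    moreover have "R p = {r, s}" unfolding R_def using r s by auto
    ultimately show "card (R p) = 2" by simp
    show "n mod p \<in> R p \<longleftrightarrow> p dvd a * n + b \<or> p dvd c * n + d"
      using \<open>R p = {r, s}\<close> r s by auto
  qed
  define G where "G = (\<Sum>S\<in>smooth_sets Q D. \<Prod>p\<in>S. 2 / (real p - 2))"
  define H where "H = (\<Sum>S\<in>smooth_sets Q y. \<Prod>p\<in>S. 1 / (real p - 1))"
  have B1: "phi_ratio K \<ge> 1" by (rule phi_ratio_ge_1)
  have GH: "H\<^sup>2 \<le> G" unfolding G_def H_def yD[symmetric]
    by (rule sum_smooth_sets_square_le) (use finQ prQ Q2 y1 in auto)
  have "ln y \<le> (\<Sum>S\<in>smooth_sets P y. \<Prod>p\<in>S. 1 / (real p - 1))"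
    by (rule ln_le_sum_smooth_sets) (use y1 finP \<open>y \<le> D\<close> in \<open>auto simp: P_def\<close>)
  also have "\<dots> \<le> phi_ratio K * H" unfolding H_def Q_def
    by (rule sum_smooth_sets_coprime) (use finP in \<open>auto simp: P_def\<close>)
  finally have "ln (real N) / 24 / phi_ratio K \<le> H" using B1 unfolding lny by (simp add: field_simps)
  then have "(ln (real N) / 24 / phi_ratio K)\<^sup>2 \<le> H\<^sup>2"
    using lnN B1 by (intro power_mono) auto
  with GH have GL: "(ln (real N) / 24 / phi_ratio K)\<^sup>2 \<le> G" by simp
  have pos: "(ln (real N) / 24 / phi_ratio K)\<^sup>2 > 0" using lnN B1 by simp
  have Gpos: "G > 0" using GL pos by linarith
  have "real N / G \<le> real N / (ln (real N) / 24 / phi_ratio K)\<^sup>2"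
    using GL pos Gpos by (intro divide_left_mono mult_pos_pos) simp_all
  also have "\<dots> = 576 * (real N / (ln (real N))\<^sup>2 * (phi_ratio K)\<^sup>2)"
    using lnN B1 by (simp add: field_simps power2_eq_square)
  finally have NG: "real N / G \<le> 576 * (real N / (ln (real N))\<^sup>2 * (phi_ratio K)\<^sup>2)" .
  let ?T = "{n. n < N \<and> (\<forall>p\<in>Q. n mod p \<notin> R p)}"
  \<comment> \<open>For \<open>n > D\<close> both prime values exceed every sieving prime, so none
    divides them; the \<open>n\<close> up to \<open>D\<close> are counted trivially.\<close>
  have "{n. n < N \<and> prime (a * n + b) \<and> prime (c * n + d)} \<subseteq> ?T \<union> {..nat \<lfloor>D\<rfloor>}"
  proof
    fix n assume n: "n \<in> {n. n < N \<and> prime (a * n + b) \<and> prime (c * n + d)}"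
    show "n \<in> ?T \<union> {..nat \<lfloor>D\<rfloor>}"
    proof (cases "n \<le> nat \<lfloor>D\<rfloor>")
      case False
      then have "real n > D" by (simp add: le_nat_floor not_le) (meson le_nat_floor not_le)
      moreover have "n \<le> a * n + b" "n \<le> c * n + d" using ac by (simp_all add: trans_le_add1)
      ultimately have D: "real (a * n + b) > D" "real (c * n + d) > D" by (meson less_le_trans of_nat_le_iff)+
      have "n mod p \<notin> R p" if p: "p \<in> Q" for p
      proof
        assume "n mod p \<in> R p"
        then have "p = a * n + b \<or> p = c * n + d"
          using Rmod[OF p] n primes_dvd_imp_eq[OF prQ[OF p]] by blast
        then show False using D QD[OF p] by auto
      qed
      then show ?thesis using n by simp
    qed simp
  qed
  then have "card {n. n < N \<and> prime (a * n + b) \<and> prime (c * n + d)} \<le> card (?T \<union> {..nat \<lfloor>D\<rfloor>})"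
    by (intro card_mono) auto
  also have "\<dots> \<le> card ?T + card {..nat \<lfloor>D\<rfloor>}" by (rule card_Un_le)
  finally have "real (card {n. n < N \<and> prime (a * n + b) \<and> prime (c * n + d)}) \<le> real (card ?T) + (D + 1)"
    using D1 by simp linarith
  also have "real (card ?T) \<le> real N / G + D ^ 4"
    unfolding G_def by (rule selberg_sieve) (use finQ prQ Q2 Rsub Rcard D1 in auto)
  finally have 1: "real (card {n. n < N \<and> prime (a * n + b) \<and> prime (c * n + d)}) \<le> real N / G + D ^ 4 + D + 1" by simp
  have "D ^ 4 \<le> real N powr (1/2)" unfolding D_def using N1 by (simp add: powr_power powr_mono)
  moreover have "D \<le> real N powr (1/2)" unfolding D_def using N1 by (simp add: powr_mono)
  moreover have "1 \<le> real N powr (1/2)" using N1 by (simp add: ge_one_powr_ge_zero)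
  \<comment> \<open>From \<open>ln t \<le> t\<close> at \<open>t = N powr (1/4)\<close>,
    squared.\<close>
  moreover have "real N powr (1/2) \<le> 16 * (real N / (ln (real N))\<^sup>2)"
  proof -
    define t where "t = real N powr (1/4)"
    have t: "t > 0" using N1 by (simp add: t_def)
    have "ln t \<le> t" using ln_le_minus_one[OF t] by simp
    then have "ln (real N) \<le> 4 * t" using N1 by (simp add: t_def ln_powr)
    then have "(ln (real N))\<^sup>2 \<le> (4 * t)\<^sup>2" using lnN by (intro power_mono) auto
    also have "\<dots> = 16 * real N powr (1/2)" using N1 by (simp add: t_def power_mult_distrib powr_power)
    finally have "real N powr (1/2) * (ln (real N))\<^sup>2 \<le> real N powr (1/2) * (16 * real N powr (1/2))"
      by (intro mult_left_mono) auto
    also have "\<dots> = 16 * real N" using N1 by (simp flip: powr_add)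
    finally show ?thesis using lnN by (simp add: field_simps)
  qed
  moreover have "real N / (ln (real N))\<^sup>2 \<le> real N / (ln (real N))\<^sup>2 * (phi_ratio K)\<^sup>2"
    using B1 N1 mult_left_mono[of 1 "(phi_ratio K)\<^sup>2" "real N / (ln (real N))\<^sup>2"] by (simp add: one_le_power)
  moreover define F where "F = real N / (ln (real N))\<^sup>2 * (phi_ratio K)\<^sup>2"
  ultimately have "D ^ 4 \<le> 16 * F" "D \<le> 16 * F" "1 \<le> 16 * F" by linarith+
  \<comment> \<open>The total is 576 + 3 * 16 = 624, where 576 = 24^2 comes from the exponent 1/24
    in \<open>y\<close>.\<close>
  then have "real (card {n. n < N \<and> prime (a * n + b) \<and> prime (c * n + d)}) \<le> 700 * F"
    using 1 NG[folded F_def] by linarith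
  then show ?thesis by (simp add: F_def)
qed

text \<open>With \<open>g = gcd p q\<close>, the solutions lie on the progression
  \<open>u = u0 + (q/g) n\<close>, \<open>v = v0 + (p/g) n\<close>, and \<open>p * u \<le> X\<close>
  forces \<open>n < N\<close>. The two forms have determinant \<open>h / g\<close>, so the modulus
  of the sieve divides \<open>2 * p * q * h\<close>.\<close>

theorem card_prime_solutions_le:
  fixes p q h X N :: nat
  assumes p: "p > 0" and q: "q > 0" and h: "h > 0" and N: "N \<ge> 2" and X: "X < N * lcm p q"
  shows "real (card {(u, v). prime u \<and> prime v \<and> p * u = q * v + h \<and> p * u \<le> X})
           \<le> 700 * real N / (ln (real N))\<^sup>2 * (phi_ratio (2 * p * q * h))\<^sup>2"
proof (cases "{(u, v). prime u \<and> prime v \<and> p * u = q * v + h \<and> p * u \<le> X} = {}")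
  case True
  show ?thesis unfolding True by simp
next
  case False
  define sol where "sol u v \<longleftrightarrow> prime u \<and> prime v \<and> p * u = q * v + h \<and> p * u \<le> X" for u v :: nat
  \<comment> \<open>Starting from the least solution makes the parameter \<open>n\<close> of every
    other one a natural number.\<close>
  define u0 where "u0 = (LEAST u. \<exists>v. sol u v)"
  obtain z where z: "z \<in> {(u, v). prime u \<and> prime v \<and> p * u = q * v + h \<and> p * u \<le> X}" using False by blast
  then have "sol (fst z) (snd z)" by (simp add: sol_def case_prod_unfold)
  then have "\<exists>u. \<exists>v. sol u v" by blast
  then have "\<exists>v. sol u0 v" unfolding u0_def by (rule LeastI_ex)
  then obtain v0 where v0: "sol u0 v0" by blast
  have u0: "u0 \<le> u" if "sol u v" for u v unfolding u0_def by (rule Least_le) (use that in blast)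
  define g where "g = gcd p q"
  have g: "g > 0" using p by (simp add: g_def)
  obtain a c where ac: "q = g * a" "p = g * c" "coprime c a"
    unfolding g_def using gcd_coprime_exists[of p q] p by (metis gcd_eq_0_iff mult.commute not_gr0)
  have a: "a > 0" and c: "c > 0" using p q ac by auto
  have lcm: "lcm p q = p * a"
  proof -
    have "lcm c a = c * a" using ac(3) by (simp add: lcm_coprime)
    then show ?thesis unfolding ac(1,2) by (simp add: lcm_mult_left)
  qed
  have "g * (c * u0) = g * (a * v0) + h" using v0 unfolding sol_def ac(1,2) by (simp add: mult_ac)
  then have "h = g * (c * u0 - a * v0)" by (simp add: diff_mult_distrib2)
  then obtain h' where h': "h = g * h'" by blast
  then have h'0: "h' > 0" using h by (cases h') auto
  have det: "c * u0 = a * v0 + h'" using \<open>g * (c * u0) = g * (a * v0) + h\<close> g unfolding h'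
    by (simp flip: distrib_left)
  have K: "nat \<bar>int a * int v0 - int u0 * int c\<bar> = h'"
  proof -
    have "int u0 * int c = int a * int v0 + int h'" using det by (metis mult.commute of_nat_add of_nat_mult)
    then show ?thesis by simp
  qed
  let ?T = "{n. n < N \<and> prime (a * n + u0) \<and> prime (c * n + v0)}"
  have "{(u, v). sol u v} \<subseteq> (\<lambda>n. (a * n + u0, c * n + v0)) ` ?T"
  proof clarify
    fix u v assume s: "sol u v"
    obtain d where d: "u = u0 + d" using u0[OF s] le_Suc_ex by blast
    have "c * u = a * v + h'" using s g unfolding sol_def ac(1,2) h' 
      by (simp add: mult.assoc flip: distrib_left)
    then have e: "a * v0 + c * d = a * v" using det d by (simp add: algebra_simps)
    then have "a dvd c * d" by (metis dvd_add_right_iff dvd_triv_left)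
    then have "a dvd d" using ac(3) by (simp add: coprime_commute coprime_dvd_mult_right_iff)
    then obtain n where n: "d = a * n" by blast
    have "a * (v0 + c * n) = a * v" using e n by (simp add: algebra_simps)
    then have v: "v = c * n + v0" using a by simp
    have "n * (p * a) \<le> X" using s d n unfolding sol_def by (simp add: algebra_simps)
    then have "n * lcm p q < N * lcm p q" using X unfolding lcm by linarith
    then have "n < N" by simp
    moreover have u: "u = a * n + u0" using d n by simp
    ultimately show "(u, v) \<in> (\<lambda>n. (a * n + u0, c * n + v0)) ` ?T"
      using s v unfolding sol_def by (intro image_eqI[of _ _ n]) auto
  qed
  then have "card {(u, v). sol u v} \<le> card ?T" by (rule surj_card_le[rotated]) simp
  also have "real (card ?T) \<le> 700 * real N / (ln (real N))\<^sup>2 * (phi_ratio (2 * a * c * h'))\<^sup>2"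
    using card_prime_pairs_le[of a c v0 u0 N] a c h'0 N K by (simp add: mult.commute)
  also have "\<dots> \<le> 700 * real N / (ln (real N))\<^sup>2 * (phi_ratio (2 * p * q * h))\<^sup>2"
  proof (intro mult_left_mono power_mono phi_ratio_mono)
    have "2 * a * c * h' dvd (2 * a * c * h') * (g * g * g)" by simp
    also have "(2 * a * c * h') * (g * g * g) = 2 * p * q * h" unfolding ac(1,2) h' by simp
    finally show "2 * a * c * h' dvd 2 * p * q * h" .
    show "phi_ratio (2 * a * c * h') \<ge> 0" using phi_ratio_ge_1[of "2 * a * c * h'"] by linarith
  qed (use p q h in auto)
  finally show ?thesis unfolding sol_def by simp
qed

section \<open>Romanoff's averaging over divisors\<close>

lemma card_multiples_le:
  assumes "e > (0::nat)"
  shows "real (card {k\<in>{1..y}. e dvd k}) \<le> real y / real e"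
proof -
  have "{k\<in>{1..y}. e dvd k} \<subseteq> (\<lambda>j. e * j) ` {1..y div e}"
  proof clarify
    fix k assume k: "k \<in> {1..y}" "e dvd k"
    then obtain j where j: "k = e * j" by blast
    have "j \<le> y div e" using k j assms by (simp add: less_eq_div_iff_mult_less_eq mult.commute)
    moreover have "j \<ge> 1" using k j by (cases j) auto
    ultimately show "k \<in> (\<lambda>j. e * j) ` {1..y div e}" using j by auto
  qed
  then have "card {k\<in>{1..y}. e dvd k} \<le> card {1..y div e}" by (rule surj_card_le[rotated]) simp
  then have "real (card {k\<in>{1..y}. e dvd k}) \<le> real (y div e)" by simp
  also have "\<dots> \<le> real y / real e" by (rule of_nat_div_le_of_nat)
  finally show ?thesis .
qed

text \<open>Romanoff's averaging argument: adding the divisors of \<open>k\<close> in increasing order, each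
  divisor \<open>e\<close> increases the exponential by at most \<open>\<Phi> e - \<Phi> (e - 1)\<close>, where \<open>\<Phi>\<close> is the
  exponential of the full partial sum.\<close>

lemma sum_exp_divisor_sum_le:
  fixes s :: "nat \<Rightarrow> real"
  assumes s: "\<And>e. s e \<ge> 0" and C: "\<And>t. t \<ge> 1 \<Longrightarrow> exp (\<Sum>e=1..t. s e) \<le> C * sqrt (real t)"
  shows "(\<Sum>k=1..y. exp (\<Sum>e\<in>{e\<in>{1..y}. e dvd k}. s e)) \<le> (1 + 3 * C) * real y"
proof (cases "y = 0")
  case False
  define \<Phi> where "\<Phi> t = exp (\<Sum>e=1..t. s e)" for t
  have \<Phi>0: "\<Phi> 0 = 1" by (simp add: \<Phi>_def)
  have \<Phi>_Suc: "\<Phi> (Suc t) = \<Phi> t * exp (s (Suc t))" for t by (simp add: \<Phi>_def exp_add)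
  have \<Phi>pos: "\<Phi> t > 0" for t by (simp add: \<Phi>_def)
  have inc: "\<Phi> (Suc t) - \<Phi> t \<ge> 0" for t
    using s[of "Suc t"] \<Phi>pos[of t] by (simp add: \<Phi>_Suc)
  have C0: "C \<ge> 0" using C[of 1] order_trans[OF exp_ge_zero] by fastforce
  have ptw: "exp (\<Sum>e\<in>{e\<in>{1..t}. e dvd k}. s e) \<le> 1 + (\<Sum>e\<in>{e\<in>{1..t}. e dvd k}. \<Phi> e - \<Phi> (e - 1))" for t k
  proof (induction t)
    case (Suc t)
    show ?case
    proof (cases "Suc t dvd k")
      case False
      then have "{e\<in>{1..Suc t}. e dvd k} = {e\<in>{1..t}. e dvd k}" by (auto simp: le_Suc_eq)
      then show ?thesis using Suc by simp
    next
      case True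
      let ?E = "{e\<in>{1..t}. e dvd k}"
      have E: "{e\<in>{1..Suc t}. e dvd k} = insert (Suc t) ?E" using True by (auto simp: le_Suc_eq)
      have fin: "finite ?E" "Suc t \<notin> ?E" by auto
      have "(\<Sum>e\<in>?E. s e) \<le> (\<Sum>e=1..t. s e)" by (rule sum_mono2) (use s in auto)
      then have le: "exp (\<Sum>e\<in>?E. s e) \<le> \<Phi> t" by (simp add: \<Phi>_def)
      have "exp (\<Sum>e\<in>insert (Suc t) ?E. s e) = exp (\<Sum>e\<in>?E. s e) + exp (\<Sum>e\<in>?E. s e) * (exp (s (Suc t)) - 1)"
        using fin by (simp add: exp_add algebra_simps)
      also have "\<dots> \<le> (1 + (\<Sum>e\<in>?E. \<Phi> e - \<Phi> (e - 1))) + \<Phi> t * (exp (s (Suc t)) - 1)"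
        using s[of "Suc t"] by (intro add_mono Suc mult_right_mono le) simp
      also have "\<dots> = 1 + (\<Sum>e\<in>insert (Suc t) ?E. \<Phi> e - \<Phi> (e - 1))"
        using fin by (simp add: \<Phi>_Suc algebra_simps)
      finally show ?thesis unfolding E .
    qed
  qed simp
  \<comment> \<open>Summation by parts in inductive form: the first term is the boundary term, -1
    comes from \<open>\<Phi> 0 = 1\<close>, and the last term majorises the sum of
    \<open>\<Phi> e / (e * (e + 1))\<close>, convergent because \<open>\<Phi>\<close> grows at most
    like a square root.\<close>
  have abel: "(\<Sum>e=1..t. (\<Phi> e - \<Phi> (e - 1)) / real e) \<le> \<Phi> t / (real t + 1) - 1 + C * (2 - 2 / sqrt (real t + 1))" for t
  proof (induction t)
    case (Suc t)
    let ?a = "sqrt (real t + 1)" and ?b = "sqrt (real t + 2)"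
    have ab: "?a > 0" "?b > 0" "?a \<le> ?b" "?a * ?a = real t + 1" "?b * ?b = real t + 2" by auto
    have "1 / ?a - 1 / ?b = (?b - ?a) / (?a * ?b)" using ab by (simp add: field_simps)
    also have "?b - ?a = 1 / (?a + ?b)"
    proof -
      have "(?b - ?a) * (?a + ?b) = 1" using ab(4,5) by (simp add: algebra_simps)
      then show ?thesis using ab(1,2) by (metis add_pos_pos eq_divide_eq less_irrefl)
    qed
    finally have d: "1 / ?a - 1 / ?b = 1 / (?a * ?b * (?a + ?b))" by (simp add: mult_ac)
    have half: "1 / z \<le> 2 * u - 2 * v" if "1 / (2 * z) \<le> u - v" for z u v :: real
    proof -
      have "1 / (2 * z) = (1 / z) / 2" by simp
      then show ?thesis using that by linarith
    qed
    have "?a * ?b * (?a + ?b) \<le> ?a * ?b * (?b + ?b)" using ab by (intro mult_left_mono) auto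
    also have "\<dots> = 2 * (?a * (real t + 2))" using ab(5) by (simp add: algebra_simps)
    finally have "1 / (2 * (?a * (real t + 2))) \<le> 1 / (?a * ?b * (?a + ?b))"
      by (intro frac_le mult_pos_pos add_pos_pos ab) auto
    then have "1 / (?a * (real t + 2)) \<le> 2 / ?a - 2 / ?b" unfolding d[symmetric]
      using half[of "?a * (real t + 2)" "1 / ?a" "1 / ?b"] by simp
    then have d': "C * (1 / (?a * (real t + 2))) \<le> C * (2 / ?a - 2 / ?b)" using C0 by (rule mult_left_mono)
    have "\<Phi> (Suc t) * (1 / ((real t + 1) * (real t + 2))) \<le> (C * ?a) * (1 / ((real t + 1) * (real t + 2)))"
      using C[of "Suc t"] by (intro mult_right_mono) (auto simp: \<Phi>_def add.commute)
    also have "\<dots> = C * (?a / (real t + 1) / (real t + 2))" by simp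
    also have "?a / (real t + 1) = 1 / ?a" using ab(1,4) by (metis divide_self_if mult.right_neutral nonzero_divide_mult_cancel_left less_irrefl)
    also have "C * (1 / ?a / (real t + 2)) = C * (1 / (?a * (real t + 2)))" by simp
    finally have 1: "\<Phi> (Suc t) * (1 / ((real t + 1) * (real t + 2))) \<le> C * (2 / ?a - 2 / ?b)" using d' by linarith
    have "1 / ((real t + 1) * (real t + 2)) = 1 / (real t + 1) - 1 / (real t + 2)" by (simp add: field_simps)
    then have "\<Phi> (Suc t) * (1 / ((real t + 1) * (real t + 2))) = \<Phi> (Suc t) / (real t + 1) - \<Phi> (Suc t) / (real t + 2)"
      by (simp only: right_diff_distrib times_divide_eq_right mult.right_neutral)
    then have "\<Phi> (Suc t) / (real t + 1) \<le> \<Phi> (Suc t) / (real t + 2) + C * (2 / ?a - 2 / ?b)"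
      using 1 by linarith
    moreover have "(\<Sum>e=1..Suc t. (\<Phi> e - \<Phi> (e - 1)) / real e) = (\<Sum>e=1..t. (\<Phi> e - \<Phi> (e - 1)) / real e) + (\<Phi> (Suc t) / (real t + 1) - \<Phi> t / (real t + 1))"
      by (simp add: diff_divide_distrib add.commute)
    ultimately show ?case using Suc by (simp add: algebra_simps)
  qed (simp add: \<Phi>0)
  have "\<Phi> y / (real y + 1) \<le> C"
  proof -
    have "sqrt (real y) \<le> real y" using False by (simp add: sqrt_le_D real_sqrt_le_iff' real_le_lsqrt self_le_power power2_eq_square)
    then have "C * sqrt (real y) \<le> C * (real y + 1)" using C0 by (intro mult_left_mono) auto
    then have "\<Phi> y \<le> C * (real y + 1)" using C[of y] False unfolding \<Phi>_def by simp
    then show ?thesis by (simp add: field_simps)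
  qed
  moreover have "C * (2 - 2 / sqrt (real y + 1)) \<le> C * 2" using C0 by (intro mult_left_mono) auto
  ultimately have T: "(\<Sum>e=1..y. (\<Phi> e - \<Phi> (e - 1)) / real e) \<le> 3 * C" using abel[of y] by linarith
  have "(\<Sum>k=1..y. exp (\<Sum>e\<in>{e\<in>{1..y}. e dvd k}. s e)) \<le> (\<Sum>k=1..y. 1 + (\<Sum>e\<in>{e\<in>{1..y}. e dvd k}. \<Phi> e - \<Phi> (e - 1)))"
    by (intro sum_mono ptw)
  also have "\<dots> = real y + (\<Sum>e=1..y. \<Sum>k\<in>{k\<in>{1..y}. e dvd k}. \<Phi> e - \<Phi> (e - 1))"
    by (subst sum.swap_restrict[symmetric]) (auto simp: sum.distrib)
  also have "(\<Sum>e=1..y. \<Sum>k\<in>{k\<in>{1..y}. e dvd k}. \<Phi> e - \<Phi> (e - 1)) \<le> (\<Sum>e=1..y. real y * ((\<Phi> e - \<Phi> (e - 1)) / real e))"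
  proof (rule sum_mono)
    fix e assume e: "e \<in> {1..y}"
    have "\<Phi> e - \<Phi> (e - 1) \<ge> 0" using inc[of "e - 1"] e by simp
    then have "real (card {k\<in>{1..y}. e dvd k}) * (\<Phi> e - \<Phi> (e - 1)) \<le> (real y / real e) * (\<Phi> e - \<Phi> (e - 1))"
      using e by (intro mult_right_mono card_multiples_le) auto
    then show "(\<Sum>k\<in>{k\<in>{1..y}. e dvd k}. \<Phi> e - \<Phi> (e - 1)) \<le> real y * ((\<Phi> e - \<Phi> (e - 1)) / real e)" by simp
  qed
  also have "\<dots> \<le> real y * (3 * C)" unfolding sum_distrib_left[symmetric] by (intro mult_left_mono T) simp
  finally show ?thesis by (simp add: algebra_simps)
qed simp

subsection \<open>Chebyshev and Mertens estimates\<close>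

text \<open>An integrality property of Leibniz' harmonic triangle: the entries
  \<open>1 / ((n + 1) (n choose k))\<close> are integer combinations of \<open>1, 1/2, \<dots>, 1/(n + 1)\<close>.\<close>

lemma leibniz_triangle_dvd:
  assumes "\<And>i. i \<in> {1..n + 1} \<Longrightarrow> i dvd (L::nat)" "k \<le> n"
  shows "(n + 1) * (n choose k) dvd L"
  using assms
proof (induction k arbitrary: n)
  case 0
  then show ?case by auto
next
  case (Suc k)
  then obtain m where m: "n = Suc m" by (cases n) auto
  have "n * ((n - 1) choose k) dvd L" using Suc.IH[of m] Suc.prems by (simp add: m)
  then obtain x where x: "L = n * ((n - 1) choose k) * x" by blast
  have "(n + 1) * (n choose k) dvd L" using Suc.IH[of n] Suc.prems by simp
  then obtain y where y: "L = (n + 1) * (n choose k) * y" by blast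
  define Z where "Z = (n + 1) * (n choose Suc k)"
  have 1: "Suc k * Z = (n + 1) * (n * ((n - 1) choose k))"
    unfolding Z_def binomial_absorption[symmetric] by (rule mult.left_commute)
  have 2: "(n - k) * ((n + 1) * (n choose k)) = Suc k * Z"
    unfolding 1 binomial_absorb_comp[symmetric] by (rule mult.left_commute)
  \<comment> \<open>The rule of the triangle, 1/((n+1) C(n,k+1)) = 1/(n C(n-1,k)) - 1/((n+1)
    C(n,k)), with denominators cleared: \<open>L = Z * (x - y)\<close>.\<close>
  have "Suc k * (Z * x) = (n + 1) * L" using 1 x by (metis mult.assoc)
  moreover have "Suc k * (Z * y) = (n - k) * L" using 2 y by (metis mult.assoc)
  moreover have "n + 1 = (n - k) + Suc k" using Suc.prems by simp
  ultimately have "Suc k * (Z * x) = Suc k * (Z * y + L)" by (metis add_mult_distrib add_mult_distrib2)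
  then have "Z * x = Z * y + L" by (metis mult_cancel1 nat.distinct(1))
  then have "Z dvd L" by (metis dvd_add_right_iff dvd_triv_left)
  then show ?case by (simp add: Z_def)
qed

text \<open>The witness is the least common multiple of 1, ..., m: each prime enters with its
  largest power dividing some \<open>i \<le> m\<close>, and that power is at most
  \<open>m\<close>.\<close>

lemma exists_common_multiple_le:
  assumes "m > 0"
  obtains L where "L > 0" "\<And>i. i \<in> {1..m} \<Longrightarrow> i dvd (L::nat)" "L \<le> m ^ card {p. prime p \<and> p \<le> m}"
proof -
  define P where "P = {p. prime p \<and> p \<le> m}"
  define e where "e p = Max (multiplicity p ` {1..m})" for p
  define L where "L = (\<Prod>p\<in>P. p ^ e p)"
  have finP: "finite P" by (simp add: P_def)
  have ple: "p ^ e p \<le> m" for p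
  proof -
    have "e p \<in> multiplicity p ` {1..m}" unfolding e_def by (rule Max_in) (use assms in auto)
    then obtain i where i: "i \<in> {1..m}" "e p = multiplicity p i" by auto
    then have "p ^ e p dvd i" by (simp add: multiplicity_dvd)
    then have "p ^ e p \<le> i" using i by (intro dvd_imp_le) auto
    then show ?thesis using i by simp
  qed
  show thesis
  proof (rule that)
    show "L > 0" unfolding L_def by (intro prod_pos) (auto simp: P_def prime_gt_0_nat)
    have "L \<le> (\<Prod>p\<in>P. m)" unfolding L_def by (intro prod_mono) (use ple in auto)
    then show "L \<le> m ^ card {p. prime p \<and> p \<le> m}" by (simp add: P_def)
    fix i assume i: "i \<in> {1..m}"
    have "i = (\<Prod>p\<in>prime_factors i. p ^ multiplicity p i)"
      using i by (intro prime_factorization_nat) simp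
    also have "\<dots> dvd L" unfolding L_def
    proof (rule prod_dvd_prod_subset2[OF finP])
      have "p \<le> m" if "p dvd i" for p using dvd_imp_le[OF that] i by simp
      then show "prime_factors i \<subseteq> P" by (auto simp: P_def)
      fix p
      have "multiplicity p i \<le> e p" unfolding e_def using i by (intro Max_ge) auto
      then show "p ^ multiplicity p i dvd p ^ e p" by (rule le_imp_power_dvd)
    qed
    finally show "i dvd L" .
  qed
qed

text \<open>Chebyshev's lower bound in Nair's manner: the number
  \<open>(2 * n + 1) * ((2 * n) choose n)\<close> is at least \<open>4 ^ n\<close> and divides any
  common multiple of 1, ..., 2n+1.\<close>

lemma four_power_le_primes: "4 ^ n \<le> (2 * n + 1) ^ card {p. prime p \<and> p \<le> 2 * n + 1}"
proof (cases "n = 0")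
  case False
  obtain L where L: "L > 0" "\<And>i. i \<in> {1..2 * n + 1} \<Longrightarrow> i dvd L" "L \<le> (2 * n + 1) ^ card {p. prime p \<and> p \<le> 2 * n + 1}"
    using exists_common_multiple_le[of "2 * n + 1"] by auto
  have "4 ^ n / (2 * real n) \<le> real ((2 * n) choose n)"
    using False by (intro central_binomial_lower_bound) simp
  then have "4 ^ n \<le> 2 * real n * real ((2 * n) choose n)" using False by (simp add: field_simps)
  also have "\<dots> \<le> real ((2 * n + 1) * ((2 * n) choose n))" by (simp add: algebra_simps)
  finally have "real (4 ^ n) \<le> real ((2 * n + 1) * ((2 * n) choose n))" by simp
  then have "4 ^ n \<le> (2 * n + 1) * ((2 * n) choose n)" by (simp only: of_nat_le_iff)
  also have "\<dots> \<le> L" by (rule dvd_imp_le[OF leibniz_triangle_dvd]) (use L in auto)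
  finally show ?thesis using L(3) by simp
qed simp

lemma chebyshev_lower:
  fixes x :: real
  assumes "x \<ge> 3"
  shows "real (card {p. prime p \<and> real p \<le> x}) \<ge> x / (8 * ln x)"
proof -
  define n where "n = nat \<lfloor>(x - 1) / 2\<rfloor>"
  have "real n = of_int \<lfloor>(x - 1) / 2\<rfloor>" using assms by (simp add: n_def)
  then have n: "real n \<le> (x - 1) / 2" "real n > (x - 1) / 2 - 1" by linarith+
  have n1: "n \<ge> 1" using assms by (simp add: n_def le_nat_iff)
  have nx: "real (2 * n + 1) \<le> x" using n by simp
  let ?p = "card {p. prime p \<and> p \<le> 2 * n + 1}"
  have lnx: "ln x > 0" using assms by simp
  have "real (4 ^ n) \<le> real ((2 * n + 1) ^ ?p)" by (rule of_nat_mono[OF four_power_le_primes])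
  then have "ln (4 ^ n) \<le> ln (real (2 * n + 1) ^ ?p)" by (subst ln_le_cancel_iff) auto
  then have "real n * ln 4 \<le> real ?p * ln (real (2 * n + 1))" by (simp add: ln_realpow)
  also have "\<dots> \<le> real ?p * ln x" using nx by (intro mult_left_mono) auto
  also have "?p \<le> card {p. prime p \<and> real p \<le> x}"
  proof (rule card_mono)
    have "{p. prime p \<and> real p \<le> x} \<subseteq> {..nat \<lfloor>x\<rfloor>}" by (auto simp: le_nat_floor)
    then show "finite {p. prime p \<and> real p \<le> x}" by (rule finite_subset) simp
    show "{p. prime p \<and> p \<le> 2 * n + 1} \<subseteq> {p. prime p \<and> real p \<le> x}"
    proof clarify
      fix p assume "p \<le> 2 * n + 1"
      then have "real p \<le> real (2 * n + 1)" by (simp only: of_nat_le_iff)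
      then show "real p \<le> x" using nx by linarith
    qed
  qed
  finally have 1: "real n * ln 4 \<le> real (card {p. prime p \<and> real p \<le> x}) * ln x"
    using lnx by (simp add: mult_right_mono)
  have "ln (4::real) \<ge> 1"
  proof -
    have "exp (1::real) \<le> 4" using exp_le by simp
    then show ?thesis by (simp add: ln_ge_iff)
  qed
  then have "real n * 1 \<le> real n * ln 4" by (intro mult_left_mono) auto
  \<comment> \<open>The general bound \<open>n > (x - 3) / 2\<close> gives this only from
    \<open>x = 4\<close> on; below that \<open>n \<ge> 1\<close> is enough.\<close>
  moreover have "x / 8 \<le> real n"
  proof (cases "x \<le> 4")
    case True
    then show ?thesis using n1 by simp
  next
    case False
    then show ?thesis using n(2) by (simp add: field_simps)
  qed
  ultimately have "x / 8 \<le> real (card {p. prime p \<and> real p \<le> x}) * ln x" using 1 by linarith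
  then show ?thesis using lnx by (simp add: field_simps)
qed

definition prime_recip_sum :: "nat \<Rightarrow> real" where
  "prime_recip_sum n = (\<Sum>p | prime p \<and> p \<le> n. 1 / real p)"

lemma prime_recip_sum_mono: "m \<le> n \<Longrightarrow> prime_recip_sum m \<le> prime_recip_sum n"
  unfolding prime_recip_sum_def by (intro sum_mono2) auto

text \<open>Euler's argument: the logarithm is at most the product of 1 + 1/(p-1) over the primes up
  to \<open>n\<close>. The factor 2 comes from 1/(p-1) <= 2/p.\<close>

lemma prime_recip_sum_lower:
  assumes "n \<ge> 2"
  shows "ln (ln (real n)) \<le> 2 * prime_recip_sum n"
proof -
  let ?P = "{p. prime p \<and> p \<le> n}"
  have finP: "finite ?P" by simp
  have p2: "real p \<ge> 2" if "prime p" for p using prime_ge_2_nat[OF that] by simp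
  have "ln (real n) \<le> (\<Sum>S\<in>smooth_sets ?P (real n). \<Prod>p\<in>S. 1 / (real p - 1))"
    by (rule ln_le_sum_smooth_sets) (use assms in auto)
  also have "\<dots> \<le> (\<Sum>S\<in>Pow ?P. \<Prod>p\<in>S. 1 / (real p - 1))"
  proof (rule sum_mono2)
    fix S assume "S \<in> Pow ?P - smooth_sets ?P (real n)"
    then show "(\<Prod>p\<in>S. 1 / (real p - 1)) \<ge> 0" by (intro prod_prime_weight_nonneg) blast
  qed (auto simp: smooth_sets_def)
  also have "\<dots> = (\<Prod>p\<in>?P. 1 / (real p - 1) + 1)" by (rule prod_add_one[OF finP, symmetric])
  also have "\<dots> \<le> (\<Prod>p\<in>?P. exp (2 / real p))"
  proof (rule prod_mono)
    fix p assume "p \<in> ?P"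
    then have p: "real p \<ge> 2" using p2 by simp
    then have "1 / (real p - 1) \<le> 2 / real p" by (simp add: field_simps)
    moreover have "1 + 2 / real p \<le> exp (2 / real p)" by (rule exp_ge_add_one_self)
    moreover have "1 / (real p - 1) \<ge> 0" using p by simp
    ultimately show "0 \<le> 1 / (real p - 1) + 1 \<and> 1 / (real p - 1) + 1 \<le> exp (2 / real p)" by linarith
  qed
  also have "\<dots> = exp (2 * prime_recip_sum n)"
    by (simp add: prime_recip_sum_def exp_sum[symmetric] sum_distrib_left)
  finally have "ln (real n) \<le> exp (2 * prime_recip_sum n)" .
  then have "ln (ln (real n)) \<le> ln (exp (2 * prime_recip_sum n))"
    using assms by (subst ln_le_cancel_iff) auto
  then show ?thesis by simp
qed

text \<open>With \<open>N = 2 ^ j\<close>, all primes in \<open>(N, 2N]\<close> divide the central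
  binomial coefficient, which is at most \<open>4 ^ N\<close>; each exceeds \<open>N\<close>, so
  there are at most \<open>2 * N / j\<close> of them.\<close>

lemma prime_recip_sum_dyadic:
  assumes "j \<ge> 1"
  shows "(\<Sum>p | prime p \<and> 2 ^ j < p \<and> p \<le> 2 ^ Suc j. 1 / real p) \<le> 2 / real j"
proof -
  define N where "N = (2::nat) ^ j"
  define T where "T = {p. prime p \<and> N < p \<and> p \<le> 2 * N}"
  have finT: "finite T" by (simp add: T_def)
  have "T \<subseteq> prime_factors ((2 * N) choose N)"
  proof
    fix p assume "p \<in> T"
    then have p: "prime p" "N < p" "p \<le> 2 * N" by (auto simp: T_def)
    have "fact N * fact N * ((2 * N) choose N) = (fact (2 * N) :: nat)"
      using binomial_fact_lemma[of N "2 * N"] by simp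
    then have "p dvd fact N * fact N * ((2 * N) choose N)" using p by (simp add: prime_dvd_fact_iff)
    then have "p dvd (2 * N) choose N" using p by (simp add: prime_dvd_mult_iff prime_dvd_fact_iff)
    then show "p \<in> prime_factors ((2 * N) choose N)" using p by (simp add: in_prime_factors_iff)
  qed
  then have "\<Prod>T dvd \<Prod>(prime_factors ((2 * N) choose N))" by (intro prod_dvd_prod_subset) auto
  then have "\<Prod>T \<le> \<Prod>(prime_factors ((2 * N) choose N))"
    by (rule dvd_imp_le) (auto intro!: prod_pos simp: prime_gt_0_nat in_prime_factors_iff)
  also have "\<dots> \<le> (2 * N) choose N" by (rule Prod_prime_factors_le) simp
  also have "\<dots> \<le> 2 ^ (2 * N)" by (rule binomial_le_pow2)
  finally have "\<Prod>T \<le> 2 ^ (2 * N)" .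
  moreover have "(\<Prod>p\<in>T. N) \<le> \<Prod>T" by (intro prod_mono) (auto simp: T_def)
  ultimately have "(2::nat) ^ (j * card T) \<le> 2 ^ (2 * N)" by (simp add: N_def power_mult)
  then have "j * card T \<le> 2 * N" by (rule power_le_imp_le_exp[rotated]) simp
  then have jT: "real j * real (card T) \<le> 2 * real N" by (metis of_nat_le_iff of_nat_mult of_nat_numeral)
  have "(\<Sum>p\<in>T. 1 / real p) \<le> (\<Sum>p\<in>T. 1 / real N)"
    by (intro sum_mono divide_left_mono) (auto simp: T_def N_def)
  also have "\<dots> = real (card T) / real N" by simp
  also have "\<dots> \<le> 2 / real j" using jT assms by (simp add: field_simps N_def)
  finally show ?thesis by (simp add: T_def N_def)
qed

lemma prime_recip_sum_pow2: "prime_recip_sum (2 ^ Suc J) \<le> 1 / 2 + (\<Sum>j=1..J. 2 / real j)"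
proof (induction J)
  case 0
  have "{p. prime p \<and> p \<le> (2::nat)} = {2}" using prime_ge_2_nat by (auto simp: le_antisym)
  then show ?case by (simp add: prime_recip_sum_def)
next
  case (Suc J)
  have "{p. prime p \<and> p \<le> 2 ^ Suc (Suc J)} = {p. prime p \<and> p \<le> 2 ^ Suc J} \<union> {p. prime p \<and> 2 ^ Suc J < p \<and> p \<le> (2::nat) ^ Suc (Suc J)}"
    by auto
  then have "prime_recip_sum (2 ^ Suc (Suc J)) = prime_recip_sum (2 ^ Suc J) + (\<Sum>p | prime p \<and> 2 ^ Suc J < p \<and> p \<le> 2 ^ Suc (Suc J). 1 / real p)"
    unfolding prime_recip_sum_def by (subst sum.union_disjoint[symmetric]) auto
  then show ?case using Suc prime_recip_sum_dyadic[of "Suc J"] by (simp del: power_Suc)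
qed

lemma harmonic_sum_le: "J \<ge> 1 \<Longrightarrow> (\<Sum>j=1..J. 1 / real j) \<le> 1 + ln (real J)"
proof (induction J rule: dec_induct)
  case (step J)
  have "ln (real J / real (Suc J)) \<le> real J / real (Suc J) - 1"
    using step by (intro ln_le_minus_one) auto
  also have "\<dots> = - (1 / real (Suc J))" by (simp add: field_simps)
  finally have "1 / real (Suc J) \<le> ln (real (Suc J)) - ln (real J)" using step by (simp add: ln_div)
  then show ?case using step by simp
qed simp

text \<open>About log n dyadic blocks cover the primes up to \<open>n\<close>; the block bounds form
  a harmonic sum, whence the iterated logarithm.\<close>

lemma prime_recip_sum_upper:
  assumes "n \<ge> 2"
  shows "prime_recip_sum n \<le> 3 + 2 * ln (log 2 (real n) + 1)"
proof -
  define J where "J = nat \<lceil>log 2 (real n)\<rceil>"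
  have l1: "log 2 (real n) \<ge> 1" using assms by simp
  have J: "J \<ge> 1" "log 2 (real n) \<le> real J" "real J \<le> log 2 (real n) + 1"
    using l1 unfolding J_def by linarith+
  have "real n = 2 powr log 2 (real n)" using assms by simp
  also have "\<dots> \<le> 2 powr real J" using J by (intro powr_mono) auto
  also have "\<dots> = real (2 ^ J)" by (simp add: powr_realpow)
  finally have "n \<le> 2 ^ J" by (simp only: of_nat_le_iff)
  also have "\<dots> \<le> 2 ^ Suc J" by simp
  finally have "prime_recip_sum n \<le> prime_recip_sum (2 ^ Suc J)" by (rule prime_recip_sum_mono)
  also have "\<dots> \<le> 1 / 2 + 2 * (\<Sum>j=1..J. 1 / real j)"
    using prime_recip_sum_pow2[of J] by (simp add: sum_distrib_left)
  also have "\<dots> \<le> 1 / 2 + 2 * (1 + ln (real J))" using harmonic_sum_le[OF J(1)] by simp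
  also have "ln (real J) \<le> ln (log 2 (real n) + 1)" using J by (subst ln_le_cancel_iff) auto
  finally show ?thesis by simp
qed

text \<open>The growth hypothesis of the averaging lemma, in a form serving both singular series:
  the left-hand side is only a power of log t. The 8 stems from fourth powers and 1/(p-1) <= 2/p;
  \<open>t\<^sup>2\<close> and \<open>+ 1\<close> stem from the primes at which 2 has order up to
  \<open>t\<close>.\<close>

lemma exp_prime_recip_sum_le:
  obtains C where "\<And>t. t \<ge> 1 \<Longrightarrow> exp (8 * (prime_recip_sum (t\<^sup>2) + 1)) \<le> C * sqrt (real t)"
proof -
  \<comment> \<open>The numerator is 8 * (3 + 2 ln l + 1) = 32 + 16 ln l exponentiated, with
    \<open>l = 2 * log 2 t + 1\<close>.\<close>
  define f where "f t = exp 32 * (2 * log 2 (real t) + 1) ^ 16 / sqrt (real t)" for t :: nat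
  have "f \<longlonglongrightarrow> 0" unfolding f_def by real_asymp
  then have "Bseq f" by (intro convergent_imp_Bseq convergentI)
  then obtain C where C: "\<And>t. norm (f t) \<le> C" by (auto simp: Bseq_def)
  show thesis
  proof (rule that)
    fix t :: nat assume t: "t \<ge> 1"
    show "exp (8 * (prime_recip_sum (t\<^sup>2) + 1)) \<le> C * sqrt (real t)"
    proof (cases "t = 1")
      case True
      have "{p. prime p \<and> p \<le> (1::nat)} = {}" by (auto dest: prime_ge_2_nat)
      then have e: "prime_recip_sum 1 = 0" unfolding prime_recip_sum_def by (simp only: sum.empty)
      have "f 1 \<le> C" using C[of 1] unfolding real_norm_def by linarith
      moreover have "f 1 = exp 32" by (simp add: f_def)
      moreover have "exp (8::real) \<le> exp 32" by (subst exp_le_cancel_iff) simp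
      ultimately have "exp 8 \<le> C" by linarith
      then show ?thesis using True e by simp
    next
      case False
      with t have t2: "t \<ge> 2" by simp
      define l where "l = 2 * log 2 (real t) + 1"
      have l: "l > 0" using t2 by (simp add: l_def add_pos_pos)
      have "t\<^sup>2 \<ge> 2" using t2 power_mono[of 2 t 2] by simp
      from prime_recip_sum_upper[OF this] have "prime_recip_sum (t\<^sup>2) \<le> 3 + 2 * ln l"
        using t2 by (simp add: l_def log_nat_power)
      then have "exp (8 * (prime_recip_sum (t\<^sup>2) + 1)) \<le> exp (32 + 16 * ln l)" by simp
      also have "\<dots> = exp 32 * l ^ 16"
      proof -
        have "exp (16 * ln l) = l ^ 16" using l exp_of_nat_mult[of 16 "ln l"] by simp
        then show ?thesis by (simp add: exp_add)
      qed
      also have "\<dots> = f t * sqrt (real t)" using t2 by (simp add: f_def l_def)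
      also have "\<dots> \<le> C * sqrt (real t)"
        using C[of t] unfolding real_norm_def by (intro mult_right_mono) auto
      finally show ?thesis .
    qed
  qed
qed

subsection \<open>Averages of singular series\<close>

lemma phi_ratio_pow4_le: "phi_ratio m ^ 4 \<le> exp (\<Sum>p\<in>prime_factors m. 8 / real p)"
proof -
  have "phi_ratio m \<le> (\<Prod>p\<in>prime_factors m. exp (2 / real p))" unfolding phi_ratio_def
  proof (rule prod_mono)
    fix p assume "p \<in> prime_factors m"
    then have "p \<ge> 2" using prime_ge_2_nat by auto
    then have p: "real p \<ge> 2" by simp
    then have "1 / (real p - 1) \<le> 2 / real p" by (simp add: field_simps)
    moreover have "1 + 2 / real p \<le> exp (2 / real p)" by (rule exp_ge_add_one_self)
    moreover have "1 / (real p - 1) \<ge> 0" using p by simp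
    ultimately show "0 \<le> 1 + 1 / (real p - 1) \<and> 1 + 1 / (real p - 1) \<le> exp (2 / real p)" by linarith
  qed
  also have "\<dots> = exp (\<Sum>p\<in>prime_factors m. 2 / real p)" by (simp add: exp_sum)
  finally have "phi_ratio m ^ 4 \<le> exp (\<Sum>p\<in>prime_factors m. 2 / real p) ^ 4"
    using phi_ratio_ge_1[of m] by (intro power_mono) auto
  also have "\<dots> = exp (\<Sum>p\<in>prime_factors m. 8 / real p)"
    by (simp add: exp_of_nat_mult[symmetric] sum_distrib_left)
  finally show ?thesis .
qed

text \<open>The averaging lemma with \<open>s\<close> supported on the primes.\<close>

lemma sum_phi_ratio_pow4_le:
  obtains C where "\<And>y. (\<Sum>k=1..y. phi_ratio k ^ 4) \<le> C * real y"
proof -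
  obtain C where C: "\<And>t. t \<ge> 1 \<Longrightarrow> exp (8 * (prime_recip_sum (t\<^sup>2) + 1)) \<le> C * sqrt (real t)"
    using exp_prime_recip_sum_le by blast
  define s where "s e = (if prime e then 8 / real e else 0)" for e :: nat
  show thesis
  proof (rule that)
    fix y
    have "(\<Sum>k=1..y. phi_ratio k ^ 4) \<le> (\<Sum>k=1..y. exp (\<Sum>e\<in>{e\<in>{1..y}. e dvd k}. s e))"
    proof (rule sum_mono)
      fix k assume k: "k \<in> {1..y}"
      have "e \<le> y" if "e dvd k" for e using dvd_imp_le[OF that] k by simp
      then have pf: "prime_factors k = {e\<in>{e\<in>{1..y}. e dvd k}. prime e}"
        using k by (auto simp: in_prime_factors_iff prime_gt_0_nat Suc_le_eq)
      have "(\<Sum>p\<in>prime_factors k. 8 / real p) = (\<Sum>e\<in>{e\<in>{1..y}. e dvd k}. s e)"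
        unfolding s_def pf by (intro sum.inter_filter) simp
      then show "phi_ratio k ^ 4 \<le> exp (\<Sum>e\<in>{e\<in>{1..y}. e dvd k}. s e)" using phi_ratio_pow4_le[of k] by simp
    qed
    also have "\<dots> \<le> (1 + 3 * C) * real y"
    proof (rule sum_exp_divisor_sum_le)
      fix t :: nat assume t: "t \<ge> 1"
      have "{e\<in>{1..t}. prime e} = {p. prime p \<and> p \<le> t}" by (auto simp: prime_gt_0_nat Suc_le_eq)
      then have "(\<Sum>e=1..t. s e) = 8 * prime_recip_sum t"
        unfolding s_def prime_recip_sum_def by (simp add: sum.inter_filter[symmetric] sum_distrib_left)
      also have "\<dots> \<le> 8 * (prime_recip_sum (t\<^sup>2) + 1)"
        using prime_recip_sum_mono[of t "t\<^sup>2"] t by (simp add: power2_eq_square)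
      finally show "exp (\<Sum>e=1..t. s e) \<le> C * sqrt (real t)" using C[OF t] by (meson exp_le_cancel_iff order_trans)
    qed (simp add: s_def)
    finally show "(\<Sum>k=1..y. phi_ratio k ^ 4) \<le> (1 + 3 * C) * real y" .
  qed
qed

lemma card_prime_factors_le:
  fixes m :: nat
  assumes "m > 0" "m < 2 ^ e"
  shows "card (prime_factors m) \<le> e"
proof -
  have "(2::nat) ^ card (prime_factors m) = (\<Prod>p\<in>prime_factors m. 2)" by simp
  also have "\<dots> \<le> \<Prod>(prime_factors m)" by (intro prod_mono) (auto simp: in_prime_factors_iff prime_ge_2_nat)
  also have "\<dots> \<le> m" by (rule Prod_prime_factors_le[OF assms(1)])
  also have "\<dots> < 2 ^ e" by (rule assms(2))
  finally have "(2::nat) ^ card (prime_factors m) < 2 ^ e" .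
  then show ?thesis by simp
qed

text \<open>The primes of \<open>A\<close> above \<open>m\<close> are at most \<open>m\<close> in
  number, each contributing less than \<open>1 / m\<close>, so all of them together add at most
  1.\<close>

lemma sum_inverse_primes_le:
  assumes "finite A" "\<And>p. p \<in> A \<Longrightarrow> prime p" "card A \<le> m"
  shows "(\<Sum>p\<in>A. 1 / real p) \<le> prime_recip_sum m + 1"
proof -
  have "(\<Sum>p\<in>A. 1 / real p) = (\<Sum>p\<in>{p\<in>A. p \<le> m}. 1 / real p) + (\<Sum>p\<in>{p\<in>A. \<not> p \<le> m}. 1 / real p)"
    using assms(1) by (subst sum.union_disjoint[symmetric]) (auto intro: sum.cong)
  also have "(\<Sum>p\<in>{p\<in>A. p \<le> m}. 1 / real p) \<le> prime_recip_sum m"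
    unfolding prime_recip_sum_def by (intro sum_mono2) (use assms in auto)
  also have "(\<Sum>p\<in>{p\<in>A. \<not> p \<le> m}. 1 / real p) \<le> 1"
  proof (cases "m = 0")
    case True
    then have "A = {}" using assms by auto
    then show ?thesis by simp
  next
    case False
    have "(\<Sum>p\<in>{p\<in>A. \<not> p \<le> m}. 1 / real p) \<le> (\<Sum>p\<in>{p\<in>A. \<not> p \<le> m}. 1 / real m)"
      using False by (intro sum_mono divide_left_mono) auto
    also have "\<dots> = real (card {p\<in>A. \<not> p \<le> m}) / real m" by simp
    also have "\<dots> \<le> 1"
    proof -
      have "card {p\<in>A. \<not> p \<le> m} \<le> m" using card_mono[OF assms(1), of "{p\<in>A. \<not> p \<le> m}"] assms(3) by auto
      then show ?thesis using False by simp
    qed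
    finally show ?thesis .
  qed
  finally show ?thesis by simp
qed

lemma prime_dvd_pow2_minus_1_iff:
  fixes p :: nat
  assumes "k \<ge> 1"
  shows "p dvd 2 ^ k - 1 \<longleftrightarrow> ord p (2::nat) dvd k"
proof -
  have "p dvd 2 ^ k - 1 \<longleftrightarrow> [2 ^ k = 1] (mod p)"
    by (metis cong_altdef_nat cong_sym_eq one_le_numeral one_le_power)
  then show ?thesis by (simp add: ord_divides')
qed

text \<open>The heart of Romanoff's theorem: a prime divides \<open>2 ^ k - 1\<close> exactly when
  the order of 2 modulo it divides \<open>k\<close>, so the exponent becomes a sum over divisors
  \<open>e\<close> of \<open>k\<close>.\<close>

lemma sum_phi_ratio_pow2_minus_1_le:
  obtains C where "\<And>y. (\<Sum>k=1..y. phi_ratio (2 ^ k - 1) ^ 4) \<le> C * real y"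
proof -
  obtain C where C: "\<And>t. t \<ge> 1 \<Longrightarrow> exp (8 * (prime_recip_sum (t\<^sup>2) + 1)) \<le> C * sqrt (real t)"
    using exp_prime_recip_sum_le by blast
  define A where "A e = {p \<in> prime_factors (2 ^ e - 1). ord p (2::nat) = e}" for e
  define s where "s e = (\<Sum>p\<in>A e. 8 / real p)" for e
  have finA: "finite (A e)" for e by (simp add: A_def)
  have m0: "(2::nat) ^ e - 1 > 0" if "e \<ge> 1" for e using that one_less_power[of "2::nat" e] by simp
  show thesis
  proof (rule that)
    fix y
    have "(\<Sum>k=1..y. phi_ratio (2 ^ k - 1) ^ 4) \<le> (\<Sum>k=1..y. exp (\<Sum>e\<in>{e\<in>{1..y}. e dvd k}. s e))"
    proof (rule sum_mono)
      fix k assume k: "k \<in> {1..y}"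
      have k1: "k \<ge> 1" using k by simp
      have ordk: "ord p (2::nat) \<in> {e\<in>{1..y}. e dvd k}" if "p \<in> prime_factors (2 ^ k - 1)" for p
      proof -
        have d: "ord p (2::nat) dvd k" using that prime_dvd_pow2_minus_1_iff[OF k1] by blast
        then have "ord p (2::nat) \<le> k" "ord p (2::nat) > 0" using k1 by (auto dest: dvd_imp_le intro!: Nat.gr0I)
        then show ?thesis using d k by auto
      qed
      have "(\<Sum>p\<in>prime_factors (2 ^ k - 1). 8 / real p)
          = (\<Sum>e\<in>{e\<in>{1..y}. e dvd k}. \<Sum>p\<in>{p \<in> prime_factors (2 ^ k - 1). ord p (2::nat) = e}. 8 / real p)"
        by (rule sum.group[symmetric]) (use ordk in auto)
      also have "\<dots> = (\<Sum>e\<in>{e\<in>{1..y}. e dvd k}. s e)" unfolding s_def A_def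
      proof (intro sum.cong refl)
        fix e assume e: "e \<in> {e\<in>{1..y}. e dvd k}"
        then have "p dvd 2 ^ k - 1 \<longleftrightarrow> p dvd 2 ^ e - 1" if "ord p (2::nat) = e" for p
          using that prime_dvd_pow2_minus_1_iff[of k p] prime_dvd_pow2_minus_1_iff[of e p] k1 by simp
        then show "{p \<in> prime_factors (2 ^ k - 1). ord p (2::nat) = e} = {p \<in> prime_factors (2 ^ e - 1). ord p (2::nat) = e}"
          using m0[of e] m0[of k] e k1 by (auto simp: in_prime_factors_iff)
      qed
      finally show "phi_ratio (2 ^ k - 1) ^ 4 \<le> exp (\<Sum>e\<in>{e\<in>{1..y}. e dvd k}. s e)"
        using phi_ratio_pow4_le[of "2 ^ k - 1"] by simp
    qed
    also have "\<dots> \<le> (1 + 3 * C) * real y"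
    proof (rule sum_exp_divisor_sum_le)
      fix t :: nat assume t: "t \<ge> 1"
      have disj: "A e \<inter> A e' = {}" if "e \<noteq> e'" for e e' using that by (auto simp: A_def)
      have "(\<Sum>e=1..t. s e) = (\<Sum>p\<in>(\<Union>e\<in>{1..t}. A e). 8 / real p)"
        unfolding s_def by (rule sum.UNION_disjoint[symmetric]) (use finA disj in auto)
      also have "\<dots> = 8 * (\<Sum>p\<in>(\<Union>e\<in>{1..t}. A e). 1 / real p)" by (simp add: sum_distrib_left)
      also have "\<dots> \<le> 8 * (prime_recip_sum (t\<^sup>2) + 1)"
      proof (intro mult_left_mono sum_inverse_primes_le)
        \<comment> \<open>As \<open>2 ^ e - 1\<close> has at most \<open>e\<close> prime factors, at
          most \<open>t\<^sup>2\<close> primes have order up to \<open>t\<close>. Only their number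
          is controlled, not their size.\<close>
        have "card (\<Union>e\<in>{1..t}. A e) \<le> (\<Sum>e=1..t. card (A e))" by (rule card_UN_le) simp
        also have "\<dots> \<le> (\<Sum>e=1..t. t)"
        proof (rule sum_mono)
          fix e assume e: "e \<in> {1..t}"
          have "card (A e) \<le> card (prime_factors (2 ^ e - 1 :: nat))" by (intro card_mono) (auto simp: A_def)
          also have "\<dots> \<le> e" by (rule card_prime_factors_le) (use m0[of e] e in auto)
          finally show "card (A e) \<le> t" using e by simp
        qed
        finally show "card (\<Union>e\<in>{1..t}. A e) \<le> t\<^sup>2" by (simp add: power2_eq_square)
      qed (use finA in \<open>auto simp: A_def\<close>)
      finally show "exp (\<Sum>e=1..t. s e) \<le> C * sqrt (real t)" using C[OF t] by (meson exp_le_cancel_iff order_trans)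
    qed (simp add: s_def sum_nonneg)
    finally show "(\<Sum>k=1..y. phi_ratio (2 ^ k - 1) ^ 4) \<le> (1 + 3 * C) * real y" .
  qed
qed

subsection \<open>Counting collisions\<close>

text \<open>Cauchy-Schwarz for the fibre sizes of \<open>f\<close>: their sum is
  \<open>card T\<close>, and the sum of their squares counts the colliding pairs.\<close>

lemma card_square_le_collisions:
  assumes "finite T"
  shows "(real (card T))\<^sup>2 \<le> real (card (f ` T)) * real (card {(s, t) \<in> T \<times> T. f s = f t})"
proof -
  define r where "r n = card {t \<in> T. f t = n}" for n
  have T: "card T = (\<Sum>n\<in>f ` T. r n)"
    using sum.image_gen[OF assms, of "\<lambda>_. 1::nat" f] by (simp add: r_def)
  have "{(s, t) \<in> T \<times> T. f s = f t} = (SIGMA s:T. {t \<in> T. f t = f s})" by auto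
  then have "card {(s, t) \<in> T \<times> T. f s = f t} = (\<Sum>s\<in>T. r (f s))"
    using assms by (simp add: r_def)
  also have "\<dots> = (\<Sum>n\<in>f ` T. \<Sum>s\<in>{s\<in>T. f s = n}. r (f s))" by (rule sum.image_gen[OF assms])
  also have "\<dots> = (\<Sum>n\<in>f ` T. (r n)\<^sup>2)"
    by (intro sum.cong refl) (simp add: r_def power2_eq_square)
  finally have P: "real (card {(s, t) \<in> T \<times> T. f s = f t}) = (\<Sum>n\<in>f ` T. (real (r n))\<^sup>2)" by simp
  have "(real (card T))\<^sup>2 = (\<Sum>n\<in>f ` T. real (r n))\<^sup>2" by (simp add: T)
  also have "\<dots> \<le> (\<Sum>n\<in>f ` T. (real (r n))\<^sup>2) * real (card (f ` T))"
    by (rule sum_squared_le_sum_of_squares)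
  finally show ?thesis unfolding P by (simp only: mult.commute)
qed

text \<open>A triple \<open>(p, a, b)\<close> represents \<open>2\<^sup>p + a b\<close>; the requirement \<open>a \<le> w < b\<close> makes the
  factorisation \<open>a b\<close> unique and keeps \<open>a\<close> small enough for the sieve.\<close>

definition triples :: "nat \<Rightarrow> nat \<Rightarrow> nat \<Rightarrow> (nat \<times> nat \<times> nat) set" where
  "triples Y w X = {(p, a, b). prime p \<and> p \<le> Y \<and> prime a \<and> a \<le> w \<and> prime b \<and> w < b \<and> a * b \<le> X}"

definition triple_value :: "nat \<times> nat \<times> nat \<Rightarrow> nat" where
  "triple_value = (\<lambda>(p, a, b). 2 ^ p + a * b)"

lemma finite_triples: "finite (triples Y w X)"
proof (rule finite_subset)
  show "triples Y w X \<subseteq> {..Y} \<times> {..w} \<times> {..X}"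
  proof (clarsimp simp: triples_def)
    fix a b :: nat assume "prime a" "a * b \<le> X"
    then have "b \<le> a * b" using prime_gt_0_nat[of a] by (cases a) auto
    then show "b \<le> X" using \<open>a * b \<le> X\<close> by (rule order_trans)
  qed
qed simp

lemma triple_value_inj:
  assumes "(p, a, b) \<in> triples Y w X" "(p, c, d) \<in> triples Y w X"
    and "triple_value (p, a, b) = triple_value (p, c, d)"
  shows "a = c \<and> b = d"
proof -
  have pr: "prime a" "prime b" "prime c" "prime d" and le: "a \<le> w" "w < d"
    using assms by (auto simp: triples_def)
  have e: "a * b = c * d" using assms(3) by (simp add: triple_value_def)
  then have "a dvd c * d" by (metis dvd_triv_left)
  then have "a dvd c \<or> a dvd d" using pr by (simp add: prime_dvd_mult_iff)
  then have "a = c" using pr le primes_dvd_imp_eq by (metis not_le)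
  then show ?thesis using e pr by (auto simp: prime_gt_0_nat)
qed

definition prime_pairs :: "nat \<Rightarrow> (nat \<times> nat) set" where
  "prime_pairs Y = {(p, p'). prime p \<and> prime p' \<and> p < p' \<and> p' \<le> Y}"

lemma finite_prime_pairs: "finite (prime_pairs Y)"
  by (rule finite_subset[of _ "{..Y} \<times> {..Y}"]) (auto simp: prime_pairs_def)

text \<open>Equal exponents force equal triples, giving the diagonal term. The remaining collisions
  come in swapped pairs, so \<open>p < p'\<close> may be assumed at the cost of the factor 2;
  \<open>S\<close> then drops the conditions \<open>w < b\<close> and \<open>w < d\<close>.\<close>

lemma card_collisions_le:
  defines "S \<equiv> \<lambda>p p' a c X. {(b, d). prime b \<and> prime d \<and> a * b = c * d + (2 ^ p' - 2 ^ p) \<and> a * b \<le> X}"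
  shows "card {(s, t) \<in> triples Y w X \<times> triples Y w X. triple_value s = triple_value t}
    \<le> card (triples Y w X) + 2 * (\<Sum>(p, p')\<in>prime_pairs Y. \<Sum>(a, c)\<in>{a. prime a \<and> a \<le> w} \<times> {c. prime c \<and> c \<le> w}. card (S p p' a c X))"
proof -
  let ?T = "triples Y w X"
  let ?W = "{a::nat. prime a \<and> a \<le> w}"
  define Off where "Off = {(s, t) \<in> ?T \<times> ?T. fst s < fst t \<and> triple_value s = triple_value t}"
  have finOff: "finite Off" unfolding Off_def
    by (rule finite_subset[of _ "?T \<times> ?T"]) (auto simp: finite_triples)
  have finS: "finite (S p p' a c X)" if "prime a" "prime c" for p p' a c
  proof (rule finite_subset)
    show "S p p' a c X \<subseteq> {..X} \<times> {..X}"
    proof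
      fix z assume "z \<in> S p p' a c X"
      then obtain b d where z: "z = (b, d)" and "a * b \<le> X" "a * b = c * d + (2 ^ p' - 2 ^ p)"
        unfolding S_def by blast
      moreover have "b \<le> a * b" using prime_gt_0_nat[OF that(1)] by (cases a) auto
      moreover have "d \<le> c * d" using prime_gt_0_nat[OF that(2)] by (cases c) auto
      ultimately have "b \<le> X \<and> d \<le> X" by linarith
      then show "z \<in> {..X} \<times> {..X}" using z by simp
    qed
  qed simp
  have "{(s, t) \<in> ?T \<times> ?T. triple_value s = triple_value t} \<subseteq> (\<lambda>t. (t, t)) ` ?T \<union> (Off \<union> prod.swap ` Off)"
  proof (rule subsetI, rule UnCI)
    fix z assume z: "z \<in> {(s, t) \<in> ?T \<times> ?T. triple_value s = triple_value t}" and n': "z \<notin> Off \<union> prod.swap ` Off"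
    obtain p a b p' c d where zz: "z = ((p, a, b), (p', c, d))" by (metis surj_pair)
    have s: "(p, a, b) \<in> ?T" and t: "(p', c, d) \<in> ?T" and v: "triple_value (p, a, b) = triple_value (p', c, d)"
      using z unfolding zz by blast+
    have n: "((p, a, b), (p', c, d)) \<notin> Off \<union> prod.swap ` Off" using n' unfolding zz .
    have "((p, a, b), (p', c, d)) \<notin> Off" using n by blast
    then have "\<not> p < p'" using s t v unfolding Off_def by simp
    moreover have "\<not> p' < p"
    proof
      assume "p' < p"
      then have "((p', c, d), (p, a, b)) \<in> Off" using s t v unfolding Off_def by simp
      then have "prod.swap ((p', c, d), (p, a, b)) \<in> prod.swap ` Off" by (rule imageI)
      then show False using n by simp
    qed
    ultimately have pp: "p = p'" by simp
    have "a = c \<and> b = d"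
      by (rule triple_value_inj[of p a b Y w X c d]) (use s t v pp in simp_all)
    then have "z = ((p, a, b), (p, a, b))" unfolding zz using pp by simp
    then show "z \<in> (\<lambda>t. (t, t)) ` ?T" using s by simp
  qed
  then have "card {(s, t) \<in> ?T \<times> ?T. triple_value s = triple_value t} \<le> card ((\<lambda>t. (t, t)) ` ?T \<union> (Off \<union> prod.swap ` Off))"
    by (intro card_mono) (auto simp: finite_triples finOff)
  also have "\<dots> \<le> card ((\<lambda>t. (t, t)) ` ?T) + card (Off \<union> prod.swap ` Off)" by (rule card_Un_le)
  also have "\<dots> \<le> card ?T + (card Off + card Off)"
    by (intro add_mono card_image_le order_trans[OF card_Un_le]) (auto simp: finite_triples finOff)
  also have "card Off \<le> card (SIGMA (p, p'):prime_pairs Y. SIGMA (a, c):?W \<times> ?W. S p p' a c X)"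
  proof (rule card_inj_on_le)
    let ?f = "\<lambda>((p::nat, a::nat, b::nat), (p'::nat, c::nat, d::nat)). ((p, p'), ((a, c), (b, d)))"
    show "inj_on ?f Off" by (rule inj_onI) auto
    show "?f ` Off \<subseteq> (SIGMA (p, p'):prime_pairs Y. SIGMA (a, c):?W \<times> ?W. S p p' a c X)"
    proof (rule image_subsetI)
      fix z assume z: "z \<in> Off"
      obtain p a b p' c d where zz: "z = ((p, a, b), (p', c, d))" by (metis surj_pair)
      have "((p, a, b), p', c, d) \<in> Off" using z zz by simp
      then have o: "(p, a, b) \<in> ?T" "(p', c, d) \<in> ?T" "p < p'" "2 ^ p + a * b = 2 ^ p' + c * d"
        by (auto simp: Off_def triple_value_def)
      have "(2::nat) ^ p \<le> 2 ^ p'" using o(3) by (intro power_increasing) auto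
      then have "a * b = c * d + (2 ^ p' - 2 ^ p)" using o(4) by linarith
      then have "(p, p') \<in> prime_pairs Y \<and> prime a \<and> a \<le> w \<and> prime c \<and> c \<le> w \<and> (b, d) \<in> S p p' a c X"
        using o(1-3) by (auto simp: triples_def prime_pairs_def S_def)
      then show "?f z \<in> (SIGMA (p, p'):prime_pairs Y. SIGMA (a, c):?W \<times> ?W. S p p' a c X)"
        using zz by simp
    qed
    show "finite (SIGMA (p, p'):prime_pairs Y. SIGMA (a, c):?W \<times> ?W. S p p' a c X)"
      by (intro finite_SigmaI) (auto simp: finite_prime_pairs finS)
  qed
  also have "card (SIGMA (p, p'):prime_pairs Y. SIGMA (a, c):?W \<times> ?W. S p p' a c X)
      = (\<Sum>z\<in>prime_pairs Y. card (case z of (p, p') \<Rightarrow> SIGMA (a, c):?W \<times> ?W. S p p' a c X))"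
    by (rule card_SigmaI[OF finite_prime_pairs]) (auto intro!: finite_SigmaI finS)
  also have "\<dots> = (\<Sum>(p, p')\<in>prime_pairs Y. \<Sum>(a, c)\<in>?W \<times> ?W. card (S p p' a c X))"
  proof (rule sum.cong[OF refl])
    fix z assume "z \<in> prime_pairs Y"
    obtain p p' where z: "z = (p, p')" by (cases z)
    have "card (SIGMA (a, c):?W \<times> ?W. S p p' a c X) = (\<Sum>u\<in>?W \<times> ?W. card (case u of (a, c) \<Rightarrow> S p p' a c X))"
      by (rule card_SigmaI) (auto intro!: finS)
    also have "\<dots> = (\<Sum>(a, c)\<in>?W \<times> ?W. card (S p p' a c X))"
      by (intro sum.cong refl) (simp add: split_beta)
    finally show "card (case z of (p, p') \<Rightarrow> SIGMA (a, c):?W \<times> ?W. S p p' a c X)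
        = (case z of (p, p') \<Rightarrow> \<Sum>(a, c)\<in>?W \<times> ?W. card (S p p' a c X))" unfolding z by simp
  qed
  finally show ?thesis by simp
qed

text \<open>The summand is \<open>1 / lcm a c\<close>, the density of solutions for fixed
  \<open>a\<close>, \<open>c\<close>. Distinct primes give a product; the second term is the
  diagonal \<open>a = c\<close>.\<close>

lemma sum_gcd_prime_recip:
  "(\<Sum>(a, c)\<in>{a::nat. prime a \<and> a \<le> w} \<times> {c. prime c \<and> c \<le> w}. real (gcd a c) / (real a * real c))
     \<le> (prime_recip_sum w)\<^sup>2 + prime_recip_sum w"
proof -
  let ?W = "{a::nat. prime a \<and> a \<le> w}"
  have "(\<Sum>(a, c)\<in>?W \<times> ?W. real (gcd a c) / (real a * real c))
      \<le> (\<Sum>(a, c)\<in>?W \<times> ?W. (1 / real a) * (1 / real c) + (if a = c then 1 / real a else 0))"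
  proof (rule sum_mono, clarify)
    fix a c :: nat assume a: "prime a" and c: "prime c"
    show "real (gcd a c) / (real a * real c) \<le> (1 / real a) * (1 / real c) + (if a = c then 1 / real a else 0)"
    proof (cases "a = c")
      case True
      then show ?thesis using prime_gt_0_nat[OF a] by simp
    next
      case False
      have "gcd a c = 1" by (rule coprime_imp_gcd_eq_1[OF primes_coprime[OF a c False]])
      then show ?thesis using False by simp
    qed
  qed
  also have "\<dots> = (\<Sum>a\<in>?W. \<Sum>c\<in>?W. (1 / real a) * (1 / real c) + (if a = c then 1 / real a else 0))"
    by (rule sum.cartesian_product[symmetric])
  also have "\<dots> = (prime_recip_sum w)\<^sup>2 + prime_recip_sum w"
    unfolding sum.distrib prime_recip_sum_def power2_eq_square sum_product by simp
  finally show ?thesis .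
qed

text \<open>The bound has the order of the number of prime pairs itself: sieving pairs with
  difference \<open>k\<close> keeps both logarithms and costs only the square of
  \<open>phi_ratio k\<close>.\<close>

lemma sum_prime_pairs_phi_ratio_le:
  obtains C where "C \<ge> 0" "\<And>Y. Y \<ge> 1 \<Longrightarrow> (\<Sum>(p, p')\<in>prime_pairs Y. (phi_ratio (2 ^ (p' - p) - 1))\<^sup>2) \<le> C * ((real Y + 1) / ln (real Y + 1))\<^sup>2"
proof -
  obtain C1 where C1: "\<And>y. (\<Sum>k=1..y. phi_ratio k ^ 4) \<le> C1 * real y"
    using sum_phi_ratio_pow4_le by blast
  obtain C2 where C2: "\<And>y. (\<Sum>k=1..y. phi_ratio (2 ^ k - 1) ^ 4) \<le> C2 * real y"
    using sum_phi_ratio_pow2_minus_1_le by blast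
  define C where "C = 1400 * (\<bar>C1\<bar> + \<bar>C2\<bar>)"
  show thesis
  proof (rule that)
    show "C \<ge> 0" by (simp add: C_def)
    fix Y :: nat assume Y: "Y \<ge> 1"
    let ?R = "\<lambda>k. phi_ratio (2 ^ k - 1)"
    define M where "M = (real Y + 1) / (ln (real Y + 1))\<^sup>2"
    have M0: "M \<ge> 0" by (simp add: M_def)
    \<comment> \<open>Here 2800 is 700 times the square of \<open>phi_ratio 2 = 2\<close>.\<close>
    have cnt: "real (card {z \<in> prime_pairs Y. snd z - fst z = k}) \<le> 2800 * M * (phi_ratio k)\<^sup>2" if k: "k \<in> {1..Y}" for k
    proof -
      have "{z \<in> prime_pairs Y. snd z - fst z = k} \<subseteq> (\<lambda>n. (n, n + k)) ` {n. n < Y + 1 \<and> prime (1 * n + 0) \<and> prime (1 * n + k)}"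
      proof
        fix z assume "z \<in> {z \<in> prime_pairs Y. snd z - fst z = k}"
        then obtain p p' where z: "z = (p, p')" "prime p" "prime p'" "p < p'" "p' \<le> Y" "p' - p = k"
          by (auto simp: prime_pairs_def)
        then have "p' = p + k" by simp
        then show "z \<in> (\<lambda>n. (n, n + k)) ` {n. n < Y + 1 \<and> prime (1 * n + 0) \<and> prime (1 * n + k)}"
          using z by (intro image_eqI[of _ _ p]) auto
      qed
      then have "card {z \<in> prime_pairs Y. snd z - fst z = k} \<le> card {n. n < Y + 1 \<and> prime (1 * n + 0) \<and> prime (1 * n + k)}"
        by (rule surj_card_le[rotated]) simp
      also have "real (card {n. n < Y + 1 \<and> prime (1 * n + 0) \<and> prime (1 * n + k)})
          \<le> 700 * real (Y + 1) / (ln (real (Y + 1)))\<^sup>2 * (phi_ratio (2 * k))\<^sup>2"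
        using card_prime_pairs_le[of 1 1 k 0 "Y + 1"] k Y by simp
      also have "\<dots> = 700 * M * (phi_ratio (2 * k))\<^sup>2" by (simp add: M_def add.commute)
      also have "\<dots> \<le> 700 * M * (2 * phi_ratio k)\<^sup>2"
      proof (intro mult_left_mono power_mono)
        have "phi_ratio (2 * k) \<le> phi_ratio 2 * phi_ratio k" using k by (intro phi_ratio_mult_le) auto
        also have "\<dots> \<le> 2 * phi_ratio k"
          using phi_ratio_prime_power_le[of 2 1] phi_ratio_ge_1[of k] by (intro mult_right_mono) auto
        finally show "phi_ratio (2 * k) \<le> 2 * phi_ratio k" .
        show "0 \<le> phi_ratio (2 * k)" using phi_ratio_ge_1[of "2 * k"] by linarith
      qed (use M0 in auto)
      finally show ?thesis by (simp add: power_mult_distrib)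
    qed
    have "(\<Sum>(p, p')\<in>prime_pairs Y. (?R (p' - p))\<^sup>2) = (\<Sum>z\<in>prime_pairs Y. (?R (snd z - fst z))\<^sup>2)"
      by (simp add: case_prod_unfold)
    also have "\<dots> = (\<Sum>k=1..Y. \<Sum>z\<in>{z \<in> prime_pairs Y. snd z - fst z = k}. (?R (snd z - fst z))\<^sup>2)"
      by (rule sum.group[symmetric, OF finite_prime_pairs]) (auto simp: prime_pairs_def)
    also have "\<dots> = (\<Sum>k=1..Y. real (card {z \<in> prime_pairs Y. snd z - fst z = k}) * (?R k)\<^sup>2)"
      by (intro sum.cong refl) simp
    also have "\<dots> \<le> (\<Sum>k=1..Y. 1400 * M * (phi_ratio k ^ 4 + ?R k ^ 4))"
    proof (rule sum_mono)
      fix k assume k: "k \<in> {1..Y}"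
      have "real (card {z \<in> prime_pairs Y. snd z - fst z = k}) * (?R k)\<^sup>2 \<le> 2800 * M * (phi_ratio k)\<^sup>2 * (?R k)\<^sup>2"
        by (intro mult_right_mono cnt k) simp
      also have "\<dots> = 1400 * M * (2 * (phi_ratio k)\<^sup>2 * (?R k)\<^sup>2)" by simp
      \<comment> \<open>The two singular series are decoupled, so that each can be averaged over all
        \<open>k\<close> on its own.\<close>
      also have "\<dots> \<le> 1400 * M * (((phi_ratio k)\<^sup>2)\<^sup>2 + ((?R k)\<^sup>2)\<^sup>2)"
        by (intro mult_left_mono sum_squares_bound) (use M0 in simp)
      finally show "real (card {z \<in> prime_pairs Y. snd z - fst z = k}) * (?R k)\<^sup>2 \<le> 1400 * M * (phi_ratio k ^ 4 + ?R k ^ 4)"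
        by (simp flip: power_mult)
    qed
    also have "\<dots> = 1400 * M * ((\<Sum>k=1..Y. phi_ratio k ^ 4) + (\<Sum>k=1..Y. ?R k ^ 4))"
      by (simp only: sum_distrib_left[symmetric] sum.distrib)
    also have "\<dots> \<le> 1400 * M * ((\<bar>C1\<bar> + \<bar>C2\<bar>) * (real Y + 1))"
    proof (rule mult_left_mono)
      have "C1 * real Y \<le> \<bar>C1\<bar> * (real Y + 1)" "C2 * real Y \<le> \<bar>C2\<bar> * (real Y + 1)"
        by (intro mult_mono; simp)+
      then show "(\<Sum>k=1..Y. phi_ratio k ^ 4) + (\<Sum>k=1..Y. ?R k ^ 4) \<le> (\<bar>C1\<bar> + \<bar>C2\<bar>) * (real Y + 1)"
        using C1[of Y] C2[of Y] unfolding distrib_right by linarith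
    qed (use M0 in auto)
    also have "\<dots> = C * ((real Y + 1) / ln (real Y + 1))\<^sup>2"
    proof -
      have "1400 * (u / l\<^sup>2) * (c * u) = 1400 * c * (u / l)\<^sup>2" for u l c :: real
        by (simp add: power_divide power2_eq_square)
      then show ?thesis unfolding M_def C_def .
    qed
    finally show "(\<Sum>(p, p')\<in>prime_pairs Y. (?R (p' - p))\<^sup>2) \<le> C * ((real Y + 1) / ln (real Y + 1))\<^sup>2" .
  qed
qed

text \<open>The difference of powers is \<open>2 ^ p * (2 ^ (p' - p) - 1)\<close>. The prime powers
  \<open>2 ^ Suc p\<close>, \<open>a\<close> and \<open>c\<close> each cost at most 2 in
  \<open>phi_ratio\<close>, so only the last factor remains in the singular series.\<close>

lemma card_off_diagonal_le:
  assumes a: "prime a" "a \<le> w" and c: "prime c" "c \<le> w" and pp: "(p, p') \<in> prime_pairs Y" and X: "w\<^sup>2 \<le> X" "w > 0"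
  shows "real (card {(b, d). prime b \<and> prime d \<and> a * b = c * d + (2 ^ p' - 2 ^ p) \<and> a * b \<le> X})
    \<le> 89600 * real X / (ln (real (X div w\<^sup>2 + 1)))\<^sup>2 * (real (gcd a c) / (real a * real c)) * (phi_ratio (2 ^ (p' - p) - 1))\<^sup>2"
proof -
  let ?k = "p' - p"
  have ac: "a > 0" "c > 0" using a c prime_gt_0_nat by auto
  have k: "p < p'" using pp by (auto simp: prime_pairs_def)
  define h where "h = (2::nat) ^ p' - 2 ^ p"
  define q where "q = (2::nat) ^ ?k - 1"
  have "(2::nat) ^ ?k > 1" using k by (intro one_less_power) auto
  then have q: "q > 0" by (simp add: q_def)
  have "(2::nat) ^ p' = 2 ^ p * 2 ^ ?k" using k by (simp flip: power_add)
  then have h: "h = 2 ^ p * q" by (simp add: h_def q_def diff_mult_distrib2)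
  have h0: "h > 0" using q by (simp add: h)
  define l where "l = lcm a c"
  have l0: "l > 0" using ac by (simp add: l_def lcm_pos_nat)
  have "a * c \<le> w * w" using a c by (intro mult_mono) auto
  moreover have "l dvd a * c" by (simp add: l_def lcm_least)
  ultimately have lw: "l \<le> w\<^sup>2" using ac dvd_imp_le[of l "a * c"] by (simp add: power2_eq_square)
  define N where "N = X div l + 1"
  \<comment> \<open>Since \<open>lcm a c \<le> w\<^sup>2\<close>, the range of the sieve is never
    shorter than \<open>X div w\<^sup>2 + 1\<close>, which gives a logarithm uniform in
    \<open>a\<close> and \<open>c\<close>.\<close>
  have "X div l \<ge> X div w\<^sup>2" using lw l0 by (rule div_le_mono2[rotated])
  moreover have "X div w\<^sup>2 \<ge> 1" using X by (simp add: div_greater_zero_iff Suc_le_eq)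
  ultimately have N: "N \<ge> 2" "X div w\<^sup>2 + 1 \<le> N" "X div w\<^sup>2 + 1 \<ge> 2" by (auto simp: N_def)
  have XN: "X < N * l" unfolding N_def using dividend_less_times_div[OF l0, of X] by (simp add: mult.commute)
  have lnpos: "ln (real (X div w\<^sup>2 + 1)) > 0" using N(3) by simp
  have lnN: "ln (real (X div w\<^sup>2 + 1)) \<le> ln (real N)" using N by (subst ln_le_cancel_iff) auto
  have phi: "phi_ratio (2 * a * c * h) \<le> 8 * phi_ratio q"
  proof -
    have "phi_ratio (2 * a * c * h) = phi_ratio (2 ^ Suc p * (a * (c * q)))" by (simp add: h mult_ac)
    also have "\<dots> \<le> phi_ratio (2 ^ Suc p) * phi_ratio (a * (c * q))"
      using ac q by (intro phi_ratio_mult_le) auto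
    also have "\<dots> \<le> phi_ratio (2 ^ Suc p) * (phi_ratio a * phi_ratio (c * q))"
      using ac q phi_ratio_ge_1[of "2 ^ Suc p"] by (intro mult_left_mono phi_ratio_mult_le) auto
    also have "\<dots> \<le> phi_ratio (2 ^ Suc p) * (phi_ratio a * (phi_ratio c * phi_ratio q))"
      using ac q phi_ratio_ge_1[of "2 ^ Suc p"] phi_ratio_ge_1[of a] by (intro mult_left_mono phi_ratio_mult_le) auto
    also have "\<dots> \<le> 2 * (2 * (2 * phi_ratio q))"
      using phi_ratio_prime_power_le[of 2 "Suc p"] phi_ratio_prime_power_le[OF a(1), of 1] phi_ratio_prime_power_le[OF c(1), of 1]
        phi_ratio_ge_1[of a] phi_ratio_ge_1[of c] phi_ratio_ge_1[of q]
      by (intro mult_mono) (auto intro!: mult_nonneg_nonneg)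
    finally show ?thesis by simp
  qed
  have Nle: "real N \<le> 2 * (real X * (real (gcd a c) / (real a * real c)))"
  proof -
    have "X div l \<ge> 1" using N(1) by (simp add: N_def)
    then have "real N \<le> 2 * real (X div l)" by (simp add: N_def)
    also have "real (X div l) \<le> real X / real l" by (rule of_nat_div_le_of_nat)
    also have "real X / real l = real X * (real (gcd a c) / (real a * real c))"
    proof -
      have "real (gcd a c) * real l = real a * real c"
        unfolding l_def by (metis of_nat_mult prod_gcd_lcm_nat)
      then show ?thesis using l0 ac by (simp add: field_simps)
    qed
    finally show ?thesis by simp
  qed
  have "real (card {(b, d). prime b \<and> prime d \<and> a * b = c * d + h \<and> a * b \<le> X})
      \<le> 700 * real N / (ln (real N))\<^sup>2 * (phi_ratio (2 * a * c * h))\<^sup>2"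
    by (rule card_prime_solutions_le) (use ac h0 N(1) XN in \<open>auto simp: l_def\<close>)
  \<comment> \<open>The constant 89600 is 700 * 2 * 8^2: the 2 rounds up \<open>N\<close>, and 8 is
    the loss in \<open>phi\<close>.\<close>
  also have "\<dots> \<le> 700 * (2 * (real X * (real (gcd a c) / (real a * real c)))) / (ln (real (X div w\<^sup>2 + 1)))\<^sup>2 * (8 * phi_ratio q)\<^sup>2"
  proof (intro mult_mono frac_le power_mono phi)
    show "0 < (ln (real (X div w\<^sup>2 + 1)))\<^sup>2" using lnpos by simp
    show "0 \<le> phi_ratio (2 * a * c * h)" using phi_ratio_ge_1[of "2 * a * c * h"] by linarith
  qed (use lnN lnpos Nle in auto)
  also have "700 * (2 * (x * g)) / l * (8 * f)\<^sup>2 = 89600 * x / l * g * f\<^sup>2" for x g l f :: real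
    by (simp add: power2_eq_square)
  finally show ?thesis unfolding h_def q_def .
qed

text \<open>The bound for each quadruple is a product of a function of \<open>(a, c)\<close> and one
  of \<open>(p, p')\<close>, so the double sum factorises.\<close>

lemma card_collisions_upper:
  obtains C where "C \<ge> 0" "\<And>Y w X. Y \<ge> 1 \<Longrightarrow> w > 0 \<Longrightarrow> w\<^sup>2 \<le> X \<Longrightarrow>
     real (card {(s, t) \<in> triples Y w X \<times> triples Y w X. triple_value s = triple_value t})
     \<le> real (card (triples Y w X)) + C * real X / (ln (real (X div w\<^sup>2 + 1)))\<^sup>2 *
         ((prime_recip_sum w)\<^sup>2 + prime_recip_sum w) * ((real Y + 1) / ln (real Y + 1))\<^sup>2"
proof -
  obtain C where C: "C \<ge> 0" "\<And>Y. Y \<ge> 1 \<Longrightarrow> (\<Sum>(p, p')\<in>prime_pairs Y. (phi_ratio (2 ^ (p' - p) - 1))\<^sup>2) \<le> C * ((real Y + 1) / ln (real Y + 1))\<^sup>2"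
    using sum_prime_pairs_phi_ratio_le by blast
  show thesis
  proof (rule that)
    show "179200 * C \<ge> 0" using C by simp
    fix Y w X :: nat assume Y: "Y \<ge> 1" and w: "w > 0" "w\<^sup>2 \<le> X"
    let ?W = "{a::nat. prime a \<and> a \<le> w}"
    let ?S = "\<lambda>p p' a c. {(b, d). prime b \<and> prime d \<and> a * b = c * d + (2 ^ p' - 2 ^ p) \<and> a * b \<le> X}"
    define A where "A = 89600 * real X / (ln (real (X div w\<^sup>2 + 1)))\<^sup>2"
    have A: "A \<ge> 0" by (simp add: A_def)
    define L where "L = (prime_recip_sum w)\<^sup>2 + prime_recip_sum w"
    have L: "L \<ge> 0" by (simp add: L_def prime_recip_sum_def sum_nonneg)
    define g where "g = (\<lambda>a c. real (gcd a c) / (real a * real c))"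
    define R where "R = (\<lambda>p p'. (phi_ratio (2 ^ (p' - p) - 1))\<^sup>2)"
    define cS where "cS = (\<lambda>p p' a c. real (card (?S p p' a c)))"
    have cS_le: "cS p p' a c \<le> A * g a c * R p p'"
      if "prime a" "a \<le> w" "prime c" "c \<le> w" "(p, p') \<in> prime_pairs Y" for a c p p'
      unfolding cS_def A_def g_def R_def by (rule card_off_diagonal_le[OF that w(2,1)])
    have gL: "(\<Sum>(a, c)\<in>?W \<times> ?W. g a c) \<le> L" unfolding g_def L_def by (rule sum_gcd_prime_recip)
    have RC: "(\<Sum>(p, p')\<in>prime_pairs Y. R p p') \<le> C * ((real Y + 1) / ln (real Y + 1))\<^sup>2"
      unfolding R_def by (rule C(2)[OF Y])
    have nn: "g a c \<ge> 0" "R p p' \<ge> 0" for a c p p' by (simp_all add: g_def R_def)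
    have "(\<Sum>(p, p')\<in>prime_pairs Y. \<Sum>(a, c)\<in>?W \<times> ?W. cS p p' a c)
        \<le> (\<Sum>(p, p')\<in>prime_pairs Y. \<Sum>(a, c)\<in>?W \<times> ?W. A * g a c * R p p')"
      by (intro sum_mono) (auto intro!: sum_mono cS_le)
    also have "\<dots> = A * (\<Sum>(a, c)\<in>?W \<times> ?W. g a c) * (\<Sum>(p, p')\<in>prime_pairs Y. R p p')"
      by (simp add: sum_distrib_left sum_distrib_right case_prod_unfold)
    also have "\<dots> \<le> A * L * (C * ((real Y + 1) / ln (real Y + 1))\<^sup>2)"
      by (intro mult_mono mult_left_mono A gL RC mult_nonneg_nonneg L sum_nonneg) (auto simp: nn)
    finally have 1: "(\<Sum>(p, p')\<in>prime_pairs Y. \<Sum>(a, c)\<in>?W \<times> ?W. real (card (?S p p' a c))) \<le> A * L * (C * ((real Y + 1) / ln (real Y + 1))\<^sup>2)"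
      unfolding cS_def .
    have "real (card {(s, t) \<in> triples Y w X \<times> triples Y w X. triple_value s = triple_value t})
        \<le> real (card (triples Y w X) + 2 * (\<Sum>(p, p')\<in>prime_pairs Y. \<Sum>(a, c)\<in>?W \<times> ?W. card (?S p p' a c)))"
      by (rule of_nat_mono[OF card_collisions_le])
    also have "\<dots> = real (card (triples Y w X)) + 2 * (\<Sum>(p, p')\<in>prime_pairs Y. \<Sum>(a, c)\<in>?W \<times> ?W. real (card (?S p p' a c)))"
      by (simp add: case_prod_unfold)
    also have "\<dots> \<le> real (card (triples Y w X)) + 2 * (A * L * (C * ((real Y + 1) / ln (real Y + 1))\<^sup>2))" using 1 by linarith
    also have "2 * (A * L * (C * ((real Y + 1) / ln (real Y + 1))\<^sup>2)) = 179200 * C * real X / (ln (real (X div w\<^sup>2 + 1)))\<^sup>2 * L * ((real Y + 1) / ln (real Y + 1))\<^sup>2"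
      by (simp add: A_def)
    finally show "real (card {(s, t) \<in> triples Y w X \<times> triples Y w X. triple_value s = triple_value t})
     \<le> real (card (triples Y w X)) + 179200 * C * real X / (ln (real (X div w\<^sup>2 + 1)))\<^sup>2 *
         ((prime_recip_sum w)\<^sup>2 + prime_recip_sum w) * ((real Y + 1) / ln (real Y + 1))\<^sup>2"
      unfolding L_def .
  qed
qed

subsection \<open>Positive lower density\<close>

text \<open>Chebyshev's bound is applied to the exponents and, for each \<open>a\<close>, to the
  primes up to \<open>X / a\<close>; summing over \<open>a\<close> produces the reciprocals of
  primes.\<close>

lemma card_triples_ge:
  assumes Y: "Y \<ge> 3" and X: "3 * w \<le> X" and w: "w \<ge> 1" and big: "16 * (real w)\<^sup>2 * ln (real X) \<le> real X"
  shows "real (card (triples Y w X)) \<ge> real Y / (8 * ln (real Y)) * (real X / (16 * ln (real X))) * prime_recip_sum w"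
proof -
  define E where "E = {p. prime p \<and> p \<le> Y}"
  define W where "W = {a. prime a \<and> a \<le> w}"
  define B where "B a = {b. prime b \<and> w < b \<and> a * b \<le> X}" for a
  have fin: "finite E" "finite W" by (simp_all add: E_def W_def)
  have X3: "real X \<ge> 3" using X w by simp
  have lnX: "ln (real X) > 0" using X3 by simp
  have a1: "a \<ge> 1" "a \<le> w" if "a \<in> W" for a
    using that prime_gt_0_nat[of a] by (auto simp: W_def)
  have finB: "finite (B a)" if "a \<in> W" for a
  proof (rule finite_subset)
    show "B a \<subseteq> {..X}"
    proof
      fix b assume "b \<in> B a"
      then have "a * b \<le> X" by (simp add: B_def)
      moreover have "b \<le> a * b" using a1(1)[OF that] by (cases a) auto
      ultimately show "b \<in> {..X}" unfolding atMost_iff by linarith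
    qed
  qed simp
  have Bge: "real X / (16 * ln (real X)) * (1 / real a) \<le> real (card (B a))" if a: "a \<in> W" for a
  proof -
    define z where "z = real X / real a"
    have ra: "real a \<ge> 1" "real a \<le> real w" using a1[OF a] by simp_all
    have "3 * real a \<le> real X" using X ra(2) by (simp flip: of_nat_le_iff)
    then have z3: "z \<ge> 3" using ra by (simp add: z_def field_simps)
    have zX: "z \<le> real X" using ra by (simp add: z_def divide_le_eq mult_le_cancel_left1)
    have "z / (8 * ln (real X)) \<le> z / (8 * ln z)"
      using z3 zX by (intro divide_left_mono mult_pos_pos) auto
    also have "\<dots> \<le> real (card {b. prime b \<and> real b \<le> z})" by (rule chebyshev_lower[OF z3])
    also have "card {b. prime b \<and> real b \<le> z} \<le> card (B a \<union> {1..w})"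
    proof (rule card_mono)
      show "finite (B a \<union> {1..w})" using finB[OF a] by simp
      show "{b. prime b \<and> real b \<le> z} \<subseteq> B a \<union> {1..w}"
      proof
        fix b assume b: "b \<in> {b. prime b \<and> real b \<le> z}"
        then have "real a * real b \<le> real X" using ra by (simp add: z_def field_simps)
        then have "a * b \<le> X" by (metis of_nat_le_iff of_nat_mult)
        then show "b \<in> B a \<union> {1..w}" using b prime_gt_0_nat[of b] by (auto simp: B_def)
      qed
    qed
    also have "\<dots> \<le> card (B a) + card {1..w}" by (rule card_Un_le)
    finally have 1: "z / (8 * ln (real X)) \<le> real (card (B a)) + real w" by simp
    \<comment> \<open>Hypothesis \<open>big\<close> lets half of Chebyshev's main term absorb the
      primes \<open>b \<le> w\<close> that have to be discarded.\<close>
    have "real w * (16 * ln (real X)) * real a \<le> real w * (16 * ln (real X)) * real w"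
      using ra lnX by (intro mult_left_mono) auto
    also have "\<dots> \<le> real X" using big by (simp add: power2_eq_square mult_ac)
    finally have "real w \<le> z / (16 * ln (real X))" using ra lnX by (simp add: z_def field_simps)
    moreover have "z / (8 * ln (real X)) = 2 * (z / (16 * ln (real X)))" by simp
    ultimately have "z / (16 * ln (real X)) \<le> real (card (B a))" using 1 by linarith
    then show ?thesis by (simp add: z_def mult.commute)
  qed
  have "triples Y w X = (SIGMA p:E. SIGMA a:W. B a)"
    unfolding triples_def E_def W_def B_def by blast
  then have "real (card (triples Y w X)) = real (card E) * (\<Sum>a\<in>W. real (card (B a)))"
    using fin finB by simp
  moreover have "\<dots> \<ge> (real Y / (8 * ln (real Y))) * (real X / (16 * ln (real X)) * prime_recip_sum w)"
  proof (intro mult_mono)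
    show "real Y / (8 * ln (real Y)) \<le> real (card E)"
      using chebyshev_lower[of "real Y"] Y by (simp add: E_def)
    show "real X / (16 * ln (real X)) * prime_recip_sum w \<le> (\<Sum>a\<in>W. real (card (B a)))"
      unfolding prime_recip_sum_def W_def[symmetric] sum_distrib_left by (intro sum_mono Bge)
    show "0 \<le> real X / (16 * ln (real X)) * prime_recip_sum w"
      using lnX by (intro mult_nonneg_nonneg) (auto simp: prime_recip_sum_def intro!: sum_nonneg)
  qed simp
  ultimately show ?thesis by (simp only: mult.assoc)
qed

lemma counting_ge_card_triples:
  assumes "(2::real) ^ Y \<le> x / 2" "real X \<le> x / 2"
  shows "card (triple_value ` triples Y w X) \<le> counting sumset_2P_P2 x"
  unfolding counting_def
proof (rule card_mono)
  have "{a \<in> sumset_2P_P2. 1 \<le> a \<and> real a \<le> x} \<subseteq> {..nat \<lfloor>x\<rfloor>}" by (auto simp: le_nat_floor)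
  then show "finite {a \<in> sumset_2P_P2. 1 \<le> a \<and> real a \<le> x}" by (rule finite_subset) simp
  show "triple_value ` triples Y w X \<subseteq> {a \<in> sumset_2P_P2. 1 \<le> a \<and> real a \<le> x}"
  proof (rule image_subsetI)
    fix z assume z: "z \<in> triples Y w X"
    obtain p a b where zz: "z = (p, a, b)" by (metis surj_pair)
    have pr: "prime p" "prime a" "prime b" and le: "p \<le> Y" "a * b \<le> X"
      using z unfolding zz triples_def by auto
    have v: "triple_value z = 2 ^ p + a * b" by (simp add: zz triple_value_def)
    have "a * b \<in> P2" using pr unfolding P2_def by blast
    then have "triple_value z \<in> sumset_2P_P2" using pr(1) unfolding v sumset_2P_P2_def by blast
    moreover have "(2::real) ^ p \<le> 2 ^ Y" using le by (intro power_increasing) auto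
    moreover have "real (a * b) \<le> real X" using le(2) by (simp only: of_nat_le_iff)
    ultimately have "2 ^ p + real (a * b) \<le> x" using assms by linarith
    then have "real (triple_value z) \<le> x" unfolding v by simp
    moreover have "1 \<le> triple_value z" unfolding v by (simp add: trans_le_add1)
    moreover note \<open>triple_value z \<in> sumset_2P_P2\<close>
    ultimately show "triple_value z \<in> {a \<in> sumset_2P_P2. 1 \<le> a \<and> real a \<le> x}" by simp
  qed
qed

text \<open>The parameters are \<open>X\<close> near x/2, \<open>w\<close> near x^(1/4) and
  \<open>Y\<close> near log2 (x/2): each summand stays below x/2, and \<open>X / w\<^sup>2\<close>
  keeps a fixed power of \<open>x\<close> for the sieve.\<close>

lemma counting_sumset_lower:
  obtains c :: real where "c > 0" "\<forall>\<^sub>F x in at_top. real (counting sumset_2P_P2 x) > c * x"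
proof -
  obtain C where C: "C \<ge> 0" "\<And>Y w X. Y \<ge> 1 \<Longrightarrow> w > 0 \<Longrightarrow> w\<^sup>2 \<le> X \<Longrightarrow>
     real (card {(s, t) \<in> triples Y w X \<times> triples Y w X. triple_value s = triple_value t})
     \<le> real (card (triples Y w X)) + C * real X / (ln (real (X div w\<^sup>2 + 1)))\<^sup>2 *
         ((prime_recip_sum w)\<^sup>2 + prime_recip_sum w) * ((real Y + 1) / ln (real Y + 1))\<^sup>2"
    using card_collisions_upper by blast
  \<comment> \<open>1728000 is 1000 * 1728, from the lower bound \<open>x / 1000\<close> for the
    triples and the constant in the collision bound. Taking 2000 in place of 1000 makes the final
    inequality strict.\<close>
  define c where "c = 1 / (2000 * (1 + 1728000 * C))"
  have c0: "c > 0" using C(1) by (simp add: c_def add_pos_nonneg)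
  have "\<forall>\<^sub>F x::real in at_top. x \<ge> 64" by (rule eventually_ge_at_top)
  moreover have "\<forall>\<^sub>F x::real in at_top. x powr (1/4) - 1 \<ge> 2" by real_asymp
  moreover have "\<forall>\<^sub>F x::real in at_top. ln (x powr (1/4) - 1) \<ge> 1" by real_asymp
  moreover have "\<forall>\<^sub>F x::real in at_top. 3 * x powr (1/4) \<le> x / 2 - 1" by real_asymp
  moreover have "\<forall>\<^sub>F x::real in at_top. x powr (1/2) \<le> x / 2 - 1" by real_asymp
  moreover have "\<forall>\<^sub>F x::real in at_top. 16 * x powr (1/2) * ln x \<le> x / 2 - 1" by real_asymp
  \<comment> \<open>The right-hand side is asymptotic to \<open>ln x / 2\<close>.\<close>
  moreover have "\<forall>\<^sub>F x::real in at_top. ln x / 3 \<le> ln ((x / 2 - 1) / x powr (1/2))" by real_asymp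
  moreover have "\<forall>\<^sub>F x::real in at_top. ln (ln x) / 2 \<le> ln (ln x - 2)" by real_asymp
  \<comment> \<open>The right-hand side is asymptotic to \<open>x / 512\<close>: the iterated
    logarithms in numerator and denominator cancel.\<close>
  moreover have "\<forall>\<^sub>F x::real in at_top. x / 1000 \<le> (ln x - 2) / (8 * ln (2 * ln x)) * ((x / 2 - 1) / (16 * ln x)) * (ln (ln (x powr (1/4) - 1)) / 2)"
    by real_asymp
  moreover have "\<forall>\<^sub>F x::real in at_top. 3 + 2 * ln (2 * ln (x powr (1/4)) + 1) \<le> 3 * ln (ln x)" by real_asymp
  moreover have "\<forall>\<^sub>F x::real in at_top. ln (ln x) \<ge> 1" by real_asymp
  ultimately have "\<forall>\<^sub>F x in at_top. real (counting sumset_2P_P2 x) > c * x"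
  proof eventually_elim
    case (elim x)
    define X where "X = nat \<lfloor>x / 2\<rfloor>"
    define w where "w = nat \<lfloor>x powr (1/4)\<rfloor>"
    define Y where "Y = nat \<lfloor>log 2 (x / 2)\<rfloor>"
    have x: "x \<ge> 64" by (rule elim(1))
    have "real X = of_int \<lfloor>x / 2\<rfloor>" using x by (simp add: X_def)
    then have Xb: "x / 2 - 1 \<le> real X" "real X \<le> x / 2" by linarith+
    have "real w = of_int \<lfloor>x powr (1/4)\<rfloor>" by (simp add: w_def)
    then have wb: "x powr (1/4) - 1 \<le> real w" "real w \<le> x powr (1/4)" by linarith+
    have lnx: "ln x > 0" using x by simp
    have x1: "ln x > 2"
    proof -
      have "ln x \<ge> ln (2 ^ 6)" using x by (subst ln_le_cancel_iff) auto
      then have "ln x \<ge> 6 * ln 2" by (subst (asm) ln_realpow) auto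
      then show ?thesis using ln2_ge_two_thirds by linarith
    qed
    have l64: "log 2 x \<ge> 6"
    proof -
      have "log 2 x \<ge> log 2 (2 ^ 6)" using x by (subst log_le_cancel_iff) auto
      then show ?thesis by (subst (asm) log_pow_cancel) auto
    qed
    have logle: "log 2 z \<le> 2 * ln z" "ln z \<le> log 2 z" if "z \<ge> 1" for z :: real
    proof -
      have "ln z * (1/2) \<le> ln z * ln 2" "ln z * ln 2 \<le> ln z * 1"
        using that ln2_ge_two_thirds ln_2_less_1 by (intro mult_left_mono; simp)+
      then show "log 2 z \<le> 2 * ln z" "ln z \<le> log 2 z" by (simp_all add: log_def field_simps)
    qed
    have lx: "log 2 x \<le> 2 * ln x" "ln x \<le> log 2 x" using logle[of x] x by simp_all
    have l2: "log 2 (x / 2) = log 2 x - 1" using x by (simp add: log_divide)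
    have "real Y = of_int \<lfloor>log 2 (x / 2)\<rfloor>" using l64 l2 by (simp add: Y_def)
    then have Yb: "log 2 x - 2 \<le> real Y" "real Y \<le> log 2 x - 1" using l2 by linarith+
    have Y3: "Y \<ge> 3" using Yb(1) l64 by linarith
    have w2: "w \<ge> 2" using elim(2) wb(1) by linarith
    have ww: "(real w)\<^sup>2 \<le> x powr (1/2)"
    proof -
      have "(real w)\<^sup>2 \<le> (x powr (1/4))\<^sup>2" using wb by (intro power_mono) auto
      also have "\<dots> = x powr (1/2)" using x by (simp add: powr_power)
      finally show ?thesis .
    qed
    have "real (3 * w) \<le> real X" using elim(4) wb(2) Xb(1) by simp
    then have wX: "3 * w \<le> X" by (simp only: of_nat_le_iff)
    have "real (w\<^sup>2) \<le> real X" using ww elim(5) Xb(1) unfolding of_nat_power by linarith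
    then have w2X: "w\<^sup>2 \<le> X" by (simp only: of_nat_le_iff)
    have X3: "real X \<ge> 3" using Xb x by linarith
    have lnX: "0 < ln (real X)" "ln (real X) \<le> ln x" using X3 Xb x by auto
    have "16 * (real w)\<^sup>2 * ln (real X) \<le> 16 * x powr (1/2) * ln x"
      using ww lnX by (intro mult_mono) auto
    then have big: "16 * (real w)\<^sup>2 * ln (real X) \<le> real X" using elim(6) Xb(1) by linarith
    let ?T = "card (triples Y w X)"
    let ?L = "prime_recip_sum w"
    have L0: "?L \<ge> 0" by (simp add: prime_recip_sum_def sum_nonneg)
    have "x / 1000 \<le> (ln x - 2) / (8 * ln (2 * ln x)) * ((x / 2 - 1) / (16 * ln x)) * (ln (ln (x powr (1/4) - 1)) / 2)"
      by (rule elim(9))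
    also have "\<dots> \<le> real Y / (8 * ln (real Y)) * (real X / (16 * ln (real X))) * ?L"
    proof (intro mult_mono frac_le mult_left_mono)
      have "ln (ln (x powr (1/4) - 1)) \<le> ln (ln (real w))"
        using elim(2,3) wb(1) by (subst ln_le_cancel_iff) (auto intro: less_le_trans[of 0 1])
      also have "\<dots> \<le> 2 * ?L" by (rule prime_recip_sum_lower[OF w2])
      finally show "ln (ln (x powr (1/4) - 1)) / 2 \<le> ?L" by simp
      show "ln (real Y) \<le> ln (2 * ln x)" using Yb Y3 lx by (subst ln_le_cancel_iff) auto
      show "0 < 8 * ln (real Y)" using Y3 by simp
      show "0 \<le> ln (ln (x powr (1/4) - 1)) / 2" using elim(3) by simp
    qed (use Yb Xb lnX X3 l64 lx x Y3 in auto)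
    also have "\<dots> \<le> real ?T" by (rule card_triples_ge[OF Y3 wX _ big]) (use w2 in simp)
    finally have T: "x / 1000 \<le> real ?T" .
    define P where "P = real (card {(s, t) \<in> triples Y w X \<times> triples Y w X. triple_value s = triple_value t})"
    have "ln ((x / 2 - 1) / x powr (1/2)) \<le> ln (real (X div w\<^sup>2 + 1))"
    proof -
      have "(x / 2 - 1) / x powr (1/2) \<le> real X / (real w)\<^sup>2"
        using Xb ww w2 x by (intro frac_le) auto
      also have "\<dots> = real X / real (w\<^sup>2)" by simp
      also have "\<dots> \<le> real (X div w\<^sup>2 + 1)"
      proof -
        have "X \<le> (X div w\<^sup>2 + 1) * w\<^sup>2" using dividend_less_times_div[of "w\<^sup>2" X] w2 by (simp add: mult.commute)
        then have "real X \<le> real (X div w\<^sup>2 + 1) * real (w\<^sup>2)" by (metis of_nat_le_iff of_nat_mult)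
        then show ?thesis using w2 by (simp add: divide_le_eq)
      qed
      finally show ?thesis using x by (subst ln_le_cancel_iff) (auto intro!: divide_pos_pos)
    qed
    with elim(7) have Lam: "ln x / 3 \<le> ln (real (X div w\<^sup>2 + 1))" by linarith
    define l where "l = ln (ln x)"
    have l1: "l \<ge> 1" using elim(11) by (simp add: l_def)
    have LU: "?L \<le> 3 * l"
    proof -
      have "log 2 (real w) \<le> log 2 (x powr (1/4))" using wb w2 x by (subst log_le_cancel_iff) auto
      moreover have "0 \<le> log 2 (real w)" using w2 by simp
      moreover have "log 2 (x powr (1/4)) \<le> 2 * ln (x powr (1/4))"
        using x by (intro logle) (auto simp: ge_one_powr_ge_zero)
      ultimately have "ln (log 2 (real w) + 1) \<le> ln (2 * ln (x powr (1/4)) + 1)" by (subst ln_le_cancel_iff) auto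
      then show ?thesis using prime_recip_sum_upper[OF w2] elim(10) unfolding l_def by linarith
    qed
    have "?L\<^sup>2 + ?L \<le> (3 * l)\<^sup>2 + 3 * l" using LU L0 by (intro add_mono power_mono) auto
    also have "\<dots> \<le> 12 * l\<^sup>2" using l1 mult_left_mono[of 1 l l] by (simp add: power2_eq_square)
    finally have LL: "?L\<^sup>2 + ?L \<le> 12 * l\<^sup>2" .
    have "ln (ln x - 2) \<le> ln (real Y + 1)"
      using Yb lx elim(8,11) x1 by (subst ln_le_cancel_iff) auto
    with elim(8) have lY: "l / 2 \<le> ln (real Y + 1)" unfolding l_def by linarith
    have YY: "(real Y + 1) / ln (real Y + 1) \<le> 2 * ln x / (l / 2)"
      by (rule frac_le[OF _ _ _ lY]) (use Yb lx l1 x1 in auto)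
    have "P \<le> real ?T + C * real X / (ln (real (X div w\<^sup>2 + 1)))\<^sup>2 * (?L\<^sup>2 + ?L) * ((real Y + 1) / ln (real Y + 1))\<^sup>2"
      unfolding P_def by (rule C(2)) (use Y3 w2 w2X in auto)
    also have "C * real X / (ln (real (X div w\<^sup>2 + 1)))\<^sup>2 * (?L\<^sup>2 + ?L) * ((real Y + 1) / ln (real Y + 1))\<^sup>2
        \<le> C * x / (ln x / 3)\<^sup>2 * (12 * l\<^sup>2) * (2 * ln x / (l / 2))\<^sup>2"
      using Xb x C(1) Lam LL Yb lx l1 lY L0 Y3 lnx
      by (intro mult_mono frac_le power_mono mult_left_mono) (auto intro!: mult_nonneg_nonneg)
    \<comment> \<open>All logarithms cancel, leaving 9 * 12 * 16 = 1728.\<close>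
    also have "\<dots> = C * x * 1728" using lnx l1 by (simp add: field_simps power2_eq_square)
    finally have "P \<le> real ?T + 1728 * (C * x)" by simp
    \<comment> \<open>As \<open>x\<close> is at most 1000 times the number of triples, collisions
      are linear in that number, and Cauchy-Schwarz yields a positive proportion of distinct
      values.\<close>
    also have "\<dots> \<le> real ?T + 1728 * (C * (1000 * real ?T))" using T C(1) by (intro add_left_mono mult_left_mono) auto
    finally have PT: "P \<le> real ?T * (1 + 1728000 * C)" by (simp add: algebra_simps)
    have "(2::real) ^ Y \<le> x / 2"
    proof -
      have "(2::real) ^ Y = 2 powr real Y" by (simp add: powr_realpow)
      also have "\<dots> \<le> 2 powr log 2 (x / 2)" using Yb l2 by (intro powr_mono) auto
      finally show ?thesis using x by simp
    qed
    then have cnt: "card (triple_value ` triples Y w X) \<le> counting sumset_2P_P2 x"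
      using Xb(2) by (rule counting_ge_card_triples)
    have "(real ?T)\<^sup>2 \<le> real (card (triple_value ` triples Y w X)) * P"
      unfolding P_def by (rule card_square_le_collisions[OF finite_triples])
    also have "\<dots> \<le> real (counting sumset_2P_P2 x) * (real ?T * (1 + 1728000 * C))"
      using cnt PT by (intro mult_mono) (auto simp: P_def)
    finally have "real ?T * real ?T \<le> real ?T * (real (counting sumset_2P_P2 x) * (1 + 1728000 * C))"
      by (simp add: power2_eq_square mult_ac)
    moreover have Tpos: "real ?T > 0" using T x by linarith
    ultimately have "real ?T \<le> real (counting sumset_2P_P2 x) * (1 + 1728000 * C)"
      by (rule mult_left_le_imp_le)
    then have "x / 1000 \<le> real (counting sumset_2P_P2 x) * (1 + 1728000 * C)" using T by linarith
    then have "x / (1000 * (1 + 1728000 * C)) \<le> real (counting sumset_2P_P2 x)"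
      using C(1) by (simp add: field_simps add_pos_nonneg)
    moreover have "x / (1000 * (1 + 1728000 * C)) = 2 * (c * x)"
    proof -
      have "x / (1000 * d) = 2 * (1 / (2000 * d) * x)" for d by simp
      then show ?thesis unfolding c_def .
    qed
    moreover have "c * x > 0" using c0 x by simp
    ultimately show "c * x < real (counting sumset_2P_P2 x)" by linarith
  qed
  with c0 show thesis by (rule that)
qed

theorem mainTheorem1:
  shows "lower_density sumset_2P_P2 > 0 \<and>
    (\<exists>c::real. c > 0 \<and> (\<forall>\<^sub>F x::real in at_top. real (counting sumset_2P_P2 x) > c * x))"
proof -
  obtain c :: real where c: "c > 0" "\<forall>\<^sub>F x in at_top. real (counting sumset_2P_P2 x) > c * x"
    by (rule counting_sumset_lower)
  have "\<forall>\<^sub>F x in at_top. ereal c \<le> ereal (real (counting sumset_2P_P2 x) / x)"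
    using c(2) eventually_gt_at_top[of 0] by eventually_elim (simp add: field_simps)
  then have "ereal c \<le> lower_density sumset_2P_P2"
    unfolding lower_density_def by (rule Liminf_bounded)
  moreover have "0 < ereal c" using c(1) by simp
  ultimately show ?thesis using c by (meson less_le_trans)
qed

end
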